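(* Let $\alpha>0$, let $p,q$ be integers with $p\neq q$, and let $u\in L^1(\mathbb{R})$ be such that ${}_{-\infty}D_x^{\alpha+2}u$ and its Fourier transform belong to $L^1(\mathbb{R})$. For $h>0$ define the weighted and shifted Grünwald difference (WSGD) operator by $${}_L\mathcal{D}_{h,p,q}^{\alpha}u(x)=\frac{\alpha-2q}{2(p-q)}A_{h,p}^{\alpha}u(x)+\frac{2p-\alpha}{2(p-q)}A_{h,q}^{\alpha}u(x).$$ Then $${}_L\mathcal{D}_{h,p,q}^{\alpha}u(x)={}_{-\infty}D_x^{\alpha}u(x)+O(h^2)$$ uniformly for $x\in\mathbb{R}$.
   Context: For $\alpha>0$ with $n-1<\alpha<n$, $n$ a positive integer, the left Riemann-Liouville fractional derivative is ${}_{-\infty}D_x^{\alpha}u(x)=\frac{1}{\Gamma(n-\alpha)}\frac{\mathrm{d}^n}{\mathrm{d}x^n}\int_{-\infty}^x\frac{u(\xi)}{(x-\xi)^{\alpha-n+1}}\,\mathrm{d}\xi$; if $\alpha=n$ it is the ordinary derivative $\frac{\mathrm{d}^n}{\mathrm{d}x^n}u(x)$. The Fourier transform is $\hat u(\omega)=\int_{\mathbb{R}}e^{-i\omega x}u(x)\,\mathrm{d}x$. For an integer $r$ and $h>0$, the shifted Grünwald difference operator is $A_{h,r}^{\alpha}u(x)=\frac{1}{h^\alpha}\sum_{k=0}^{\infty}g_k^{(\alpha)}u(x-(k-r)h)$, where $g_k^{(\alpha)}=(-1)^k\binom{\alpha}{k}$ are the coefficients of the power series $(1-z)^\alpha=\sum_{k\ge0}g_k^{(\alpha)}z^k$;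 that is, $g_0^{(\alpha)}=1$ and $g_k^{(\alpha)}=\left(1-\frac{\alpha+1}{k}\right)g_{k-1}^{(\alpha)}$ for $k\ge1$. "$O(h^2)$ uniformly for $x\in\mathbb{R}$" means that the absolute difference is bounded by $Ch^2$ as $h\to0^+$, with $C$ independent of $x$ and $h$.
   Formalization: The estimate is stated for the continuous representative of u (shown to exist, equal to u if u is continuous), since for non-integer α changing u at one point keeps the hypotheses but breaks the pointwise bound; the derivative of order α+2 is taken to exist at every x. *)

theory Defs
  imports "HOL-Analysis.Analysis"
begin

definition fourier :: "(real \<Rightarrow> complex) \<Rightarrow> real \<Rightarrow> complex" where
  "fourier u \<omega> = (LINT x|lborel. exp (- (\<i> * of_real (\<omega> * x))) * u x)"

definition nth_deriv :: "nat \<Rightarrow> (real \<Rightarrow> complex) \<Rightarrow> real \<Rightarrow> complex" where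
  "nth_deriv n f = ((\<lambda>g x. vector_derivative g (at x)) ^^ n) f"

definition times_differentiable :: "nat \<Rightarrow> (real \<Rightarrow> complex) \<Rightarrow> bool" where
  "times_differentiable n f \<longleftrightarrow> (\<forall>k<n. \<forall>x. nth_deriv k f differentiable (at x))"

text \<open>The order of a derivative of order \<open>\<alpha> > 0\<close> is the integer \<open>n\<close> with \<open>n - 1 < \<alpha> \<le> n\<close>.\<close>

definition rl_order :: "real \<Rightarrow> nat" where
  "rl_order \<alpha> = nat \<lceil>\<alpha>\<rceil>"

definition rl_integrand :: "real \<Rightarrow> (real \<Rightarrow> complex) \<Rightarrow> real \<Rightarrow> real \<Rightarrow> complex" where
  "rl_integrand \<alpha> u x \<xi> = u \<xi> / of_real ((x - \<xi>) powr (\<alpha> - real (rl_order \<alpha>) + 1))"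

definition rl_integral :: "real \<Rightarrow> (real \<Rightarrow> complex) \<Rightarrow> real \<Rightarrow> complex" where
  "rl_integral \<alpha> u x = (LINT \<xi>:{..<x}|lborel. rl_integrand \<alpha> u x \<xi>)"

definition rl_deriv :: "real \<Rightarrow> (real \<Rightarrow> complex) \<Rightarrow> real \<Rightarrow> complex" where
  "rl_deriv \<alpha> u x =
     (if \<alpha> = real (rl_order \<alpha>) then nth_deriv (rl_order \<alpha>) u x
      else of_real (1 / Gamma (real (rl_order \<alpha>) - \<alpha>)) *
             nth_deriv (rl_order \<alpha>) (rl_integral \<alpha> u) x)"

text \<open>
  \<^const>\<open>rl_deriv\<close> is a total function, with junk values where an integral diverges or a
  derivative does not exist. The following predicate says that it is meaningful at every real
  point.
\<close>

definition rl_differentiable :: "real \<Rightarrow> (real \<Rightarrow> complex) \<Rightarrow> bool" where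
  "rl_differentiable \<alpha> u \<longleftrightarrow>
     (if \<alpha> = real (rl_order \<alpha>) then times_differentiable (rl_order \<alpha>) u
      else (\<forall>x. set_integrable lborel {..<x} (rl_integrand \<alpha> u x)) \<and>
           times_differentiable (rl_order \<alpha>) (rl_integral \<alpha> u))"

definition grunwald_coeff :: "real \<Rightarrow> nat \<Rightarrow> real" where
  "grunwald_coeff \<alpha> k = (-1) ^ k * (\<alpha> gchoose k)"

definition grunwald_term ::
    "real \<Rightarrow> int \<Rightarrow> real \<Rightarrow> (real \<Rightarrow> complex) \<Rightarrow> real \<Rightarrow> nat \<Rightarrow> complex" where
  "grunwald_term \<alpha> r h u x k =
     of_real (grunwald_coeff \<alpha> k) * u (x - (real k - real_of_int r) * h)"

definition grunwald ::
    "real \<Rightarrow> int \<Rightarrow> real \<Rightarrow> (real \<Rightarrow> complex) \<Rightarrow> real \<Rightarrow> complex" where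
  "grunwald \<alpha> r h u x = of_real (1 / h powr \<alpha>) * (\<Sum>k. grunwald_term \<alpha> r h u x k)"

definition wsgd ::
    "real \<Rightarrow> int \<Rightarrow> int \<Rightarrow> real \<Rightarrow> (real \<Rightarrow> complex) \<Rightarrow> real \<Rightarrow> complex" where
  "wsgd \<alpha> p q h u x =
     of_real ((\<alpha> - 2 * real_of_int q) / (2 * (real_of_int p - real_of_int q))) * grunwald \<alpha> p h u x +
     of_real ((2 * real_of_int p - \<alpha>) / (2 * (real_of_int p - real_of_int q))) * grunwald \<alpha> q h u x"

end

theory Submission
  imports Defs "HOL-Probability.Levy" "HOL-Real_Asymp.Real_Asymp"
begin

text \<open>
  Let \<open>n\<close> be the order of \<open>\<alpha>\<close>, \<open>\<sigma> = n - \<alpha>\<close>, and let \<open>F\<close> be the Riemann--Liouville integral of \<open>u\<close>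
  (\<open>F = u\<close> if \<open>\<sigma> = 0\<close>), that is, the convolution of \<open>u\<close> with \<open>t powr (\<sigma> - 1)\<close> on \<open>t > 0\<close>. Neither this
  kernel nor \<open>F\<close> is integrable, but their backward differences with step \<open>h\<close> are, and their Fourier
  transforms carry the factor \<open>1 - exp (- \<i> \<omega> h)\<close>. Computing the transform of the \<open>(n + 2)\<close>-fold
  difference of \<open>F\<close> once from the kernel and once from the \<open>(n + 2)\<close>-th derivative of \<open>F\<close>, with
  \<open>h = pi / \<bar>\<omega>\<bar>\<close> so that the factor is \<open>2\<close>, shows that the transform of \<open>D\<^sup>\<alpha>\<^sup>+\<^sup>2 u\<close> is \<open>(\<i> \<omega>) powr (\<alpha> + 2)\<close>
  times that of \<open>u\<close>. Hence \<open>\<bar>\<omega>\<bar> powr (\<alpha> + 2)\<close> times the transform of \<open>u\<close> is integrable, \<open>u\<close> agrees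
  almost everywhere with the inverse transform \<open>v\<close> of its transform, and \<open>D\<^sup>\<alpha> v\<close> and the WSGD difference of \<open>v\<close>
  are Fourier multipliers applied to \<open>u\<close>. Their symbols differ by at most \<open>C h\<^sup>2 \<bar>\<omega>\<bar> powr (\<alpha> + 2)\<close>,
  because the weights make the Taylor expansion of the symbol quotient at \<open>0\<close> start with \<open>1 + O((h \<omega>)\<^sup>2)\<close>.
\<close>

section \<open>Fourier transforms of integrable functions\<close>

lemma borel_measurable_cis [measurable]:
  "f \<in> borel_measurable M \<Longrightarrow> (\<lambda>x. cis (f x)) \<in> borel_measurable M"
  by (rule borel_measurable_continuous_on[OF continuous_on_cis[OF continuous_on_id]])

lemma set_integrable_lborelI:
  fixes f :: "real \<Rightarrow> 'a :: {banach, second_countable_topology}"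
  assumes "integrable lborel f" "A \<in> sets borel"
  shows "set_integrable lborel A f"
  unfolding set_integrable_def by (intro integrable_mult_indicator) (use assms in auto)

lemma fourier_cis: "fourier u \<omega> = (LINT x|lborel. cis (- (\<omega> * x)) * u x)"
  by (simp add: fourier_def cis_conv_exp)

lemma integrable_cis_mult:
  fixes f :: "'a \<Rightarrow> complex"
  assumes "integrable M f" "g \<in> borel_measurable M"
  shows "integrable M (\<lambda>x. cis (g x) * f x)"
  by (rule Bochner_Integration.integrable_bound[OF assms(1)])
     (use assms in \<open>auto simp: norm_mult\<close>)

lemma borel_measurable_fourier [measurable]:
  assumes [measurable]: "u \<in> borel_measurable borel"
  shows "fourier u \<in> borel_measurable borel"
  unfolding fourier_cis[abs_def] by measurable

lemma norm_fourier_le: "norm (fourier u \<omega>) \<le> (LINT x|lborel. norm (u x))"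
  unfolding fourier_cis by (rule order_trans[OF integral_norm_bound]) (simp add: norm_mult)

lemma fourier_cong_AE:
  assumes "AE x in lborel. u x = v x"
    "u \<in> borel_measurable borel" "v \<in> borel_measurable borel"
  shows "fourier u = fourier v"
  unfolding fourier_cis[abs_def]
  by (intro ext integral_cong_AE) (use assms in auto)

lemma fourier_diff:
  assumes "integrable lborel u" "integrable lborel v"
  shows "fourier (\<lambda>x. u x - v x) \<omega> = fourier u \<omega> - fourier v \<omega>"
  unfolding fourier_cis ring_distribs
  by (intro Bochner_Integration.integral_diff integrable_cis_mult assms) auto

lemma integrable_shift:
  fixes f :: "real \<Rightarrow> complex"
  shows "integrable lborel f \<Longrightarrow> integrable lborel (\<lambda>x. f (x - h))"
  using lborel_integrable_real_affine[of f 1 "-h"] by (simp add: add.commute)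

lemma fourier_shift: "fourier (\<lambda>x. f (x - h)) \<omega> = cis (- (\<omega> * h)) * fourier f \<omega>"
proof -
  have "fourier (\<lambda>x. f (x - h)) \<omega> = (LINT x|lborel. cis (- (\<omega> * (h + x))) * f x)"
    using lborel_integral_real_affine[of 1 "\<lambda>x. cis (- (\<omega> * x)) * f (x - h)" h]
    by (simp add: fourier_cis)
  also have "\<dots> = (LINT x|lborel. cis (- (\<omega> * h)) * (cis (- (\<omega> * x)) * f x))"
    by (simp only: mult.assoc[symmetric] cis_mult minus_add_distrib ring_distribs)
  finally show ?thesis by (simp only: fourier_cis integral_mult_right_zero)
qed

text \<open>Translation invariance makes the inner integral of the norm equal to
  \<open>norm (f y)\<close> times the L1 norm of \<open>g\<close>, so Fubini applies. After the
  exchange the inner transform is that of a shifted \<open>g\<close>, and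
  \<open>fourier_shift\<close> supplies the factor \<open>cis (- (\<omega> * y))\<close> that
  completes the transform of \<open>f\<close>.\<close>

lemma convolution_L1:
  fixes f g :: "real \<Rightarrow> complex"
  assumes f: "integrable lborel f" and g: "integrable lborel g"
  shows integrable_convolution: "integrable lborel (\<lambda>x. LINT y|lborel. f y * g (x - y))"
    and fourier_convolution:
      "fourier (\<lambda>x. LINT y|lborel. f y * g (x - y)) \<omega> = fourier f \<omega> * fourier g \<omega>"
proof -
  have [measurable]: "f \<in> borel_measurable borel" "g \<in> borel_measurable borel"
    using f g by auto
  have *: "integrable (lborel \<Otimes>\<^sub>M lborel) (\<lambda>(y, x). f y * g (x - y))"
  proof (rule lborel_pair.Fubini_integrable)
    have "(LINT x|lborel. norm (f y * g (x - y))) = norm (f y) * (LINT x|lborel. norm (g x))" for y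
      using lborel_integral_real_affine[of 1 "\<lambda>x. norm (g x)" "- y"]
      by (simp add: norm_mult add.commute)
    thus "integrable lborel (\<lambda>y. LINT x|lborel. norm (case (y, x) of (y, x) \<Rightarrow> f y * g (x - y)))"
      using f by simp
    show "AE y in lborel. integrable lborel (\<lambda>x. case (y, x) of (y, x) \<Rightarrow> f y * g (x - y))"
      using integrable_shift[OF g] by simp
  qed measurable
  hence **: "integrable (lborel \<Otimes>\<^sub>M lborel) (\<lambda>(x, y). f y * g (x - y))"
    by (subst (asm) lborel_pair.integrable_product_swap_iff[symmetric]) (simp add: case_prod_unfold)
  from lborel_pair.integrable_fst'[OF **]
  show "integrable lborel (\<lambda>x. LINT y|lborel. f y * g (x - y))" by simp
  have "integrable (lborel \<Otimes>\<^sub>M lborel) (\<lambda>(x, y). cis (- (\<omega> * x)) * (f y * g (x - y)))"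
    using integrable_cis_mult[OF **, of "\<lambda>z. - (\<omega> * fst z)"] by (simp add: case_prod_unfold)
  note Fub = lborel_pair.Fubini_integral[OF this]
  have "fourier (\<lambda>x. LINT y|lborel. f y * g (x - y)) \<omega> =
      (LINT x|lborel. LINT y|lborel. cis (- (\<omega> * x)) * (f y * g (x - y)))"
    unfolding fourier_cis by simp
  also have "\<dots> = (LINT y|lborel. LINT x|lborel. cis (- (\<omega> * x)) * (f y * g (x - y)))"
    using Fub by simp
  also have "\<dots> = (LINT y|lborel. f y * fourier (\<lambda>x. g (x - y)) \<omega>)"
    unfolding fourier_cis
    by (simp only: mult.left_commute[of "cis _"] integral_mult_right_zero)
  also have "\<dots> = (LINT y|lborel. cis (- (\<omega> * y)) * f y * fourier g \<omega>)"
    by (intro Bochner_Integration.integral_cong refl) (simp only: fourier_shift mult_ac)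
  also have "\<dots> = fourier f \<omega> * fourier g \<omega>"
    by (simp only: integral_mult_left_zero fourier_cis[of f])
  finally show "fourier (\<lambda>x. LINT y|lborel. f y * g (x - y)) \<omega> = fourier f \<omega> * fourier g \<omega>" .
qed

section \<open>Fourier inversion\<close>

definition fourier_inv :: "(real \<Rightarrow> complex) \<Rightarrow> real \<Rightarrow> complex" where
  "fourier_inv \<psi> x = 1 / (2 * pi) * (LINT \<omega>|lborel. cis (\<omega> * x) * \<psi> \<omega>)"

text \<open>The positive and negative parts of \<open>f\<close> are densities of two finite Borel
  measures. The hypothesis makes their distribution functions agree, hence the measures agree, and
  densities are unique almost everywhere.\<close>

lemma AE_eq_0_if_integral_atMost_0:
  fixes f :: "real \<Rightarrow> real"
  assumes f: "integrable lborel f" and 0: "\<And>x. (LINT t:{..x}|lborel. f t) = 0"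
  shows "AE x in lborel. f x = 0"
proof -
  have [measurable]: "f \<in> borel_measurable borel" using f by auto
  define P N where "P = (\<lambda>x. max 0 (f x))" and "N = (\<lambda>x. max 0 (- f x))"
  have PN: "integrable lborel P" "integrable lborel N"
    unfolding P_def N_def using f by auto
  have [measurable]: "P \<in> borel_measurable borel" "N \<in> borel_measurable borel"
    unfolding P_def N_def by measurable
  define M where "M = (\<lambda>g::real \<Rightarrow> real. density lborel (\<lambda>x. ennreal (g x)))"
  have M: "finite_borel_measure (M g)" "cdf (M g) x = (LINT t:{..x}|lborel. g t)"
    if g: "integrable lborel g" "\<And>x. 0 \<le> g x" for g x
  proof -
    have [measurable]: "g \<in> borel_measurable borel" using g by auto
    have "emeasure (M g) UNIV = ennreal (integral\<^sup>L lborel g)"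
      unfolding M_def using g by (subst emeasure_density) (auto intro!: nn_integral_eq_integral)
    thus "finite_borel_measure (M g)"
      unfolding finite_borel_measure_def finite_borel_measure_axioms_def
      by (auto intro!: finite_measureI simp: M_def)
    have "emeasure (M g) {..x} = (\<integral>\<^sup>+t. ennreal (indicator {..x} t * g t) \<partial>lborel)"
      unfolding M_def
      by (subst emeasure_density) (auto intro!: nn_integral_cong split: split_indicator)
    also have "\<dots> = ennreal (LINT t:{..x}|lborel. g t)"
      unfolding set_lebesgue_integral_def
      using g integrable_mult_indicator[of "{..x}" lborel g]
      by (subst nn_integral_eq_integral) auto
    finally show "cdf (M g) x = (LINT t:{..x}|lborel. g t)"
      unfolding cdf_def measure_def set_lebesgue_integral_def
      using g by (simp add: integral_nonneg_AE)
  qed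
  have "cdf (M P) x = cdf (M N) x" for x
  proof -
    have "(LINT t:{..x}|lborel. P t) - (LINT t:{..x}|lborel. N t) = (LINT t:{..x}|lborel. P t - N t)"
      by (rule set_integral_diff(2)[symmetric])
         (use PN in \<open>auto intro!: set_integrable_lborelI\<close>)
    also have "(\<lambda>t. P t - N t) = f"
      by (auto simp: P_def N_def)
    finally show ?thesis using 0[of x] PN by (simp add: M(2) P_def N_def)
  qed
  hence "M P = M N"
    using PN by (intro cdf_unique' M) (auto simp: P_def N_def)
  hence "AE x in lborel. ennreal (P x) = ennreal (N x)"
    unfolding M_def by (intro sigma_finite_measure.density_unique[OF sigma_finite_lborel]) auto
  thus ?thesis
    by eventually_elim (auto simp: P_def N_def max_def split: if_splits)
qed

text \<open>Only local integrability is assumed, because this is applied to a difference containing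
  an inverse transform, which need not be integrable on the whole line. Truncation to
  \<open>{- real n<..real n}\<close> and separation of real and imaginary parts reduce it to
  half-lines.\<close>

lemma AE_eq_0_if_interval_integrals_0:
  fixes f :: "real \<Rightarrow> complex"
  assumes f: "\<And>a b. set_integrable lborel {a<..b} f"
    and 0: "\<And>a b. a \<le> b \<Longrightarrow> (LINT t:{a<..b}|lborel. f t) = 0"
  shows "AE x in lborel. f x = 0"
proof -
  have "AE x in lborel. \<forall>n::nat. Re (indicator {- real n<..real n} x * f x) = 0 \<and>
                                 Im (indicator {- real n<..real n} x * f x) = 0"
  proof (subst AE_all_countable, intro allI)
    fix n :: nat
    define g where "g = (\<lambda>x. indicator {- real n<..real n} x * f x)"
    have g: "integrable lborel g"
      using f[of "- real n" "real n"]
      by (simp add: set_integrable_def g_def scaleR_conv_of_real of_real_indicator)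
    have g0: "(LINT t:{..x}|lborel. g t) = 0" for x
    proof -
      \<comment> \<open>The half-line meets the truncation in an interval; the outer
        \<open>max\<close> covers \<open>x\<close> to the left of it, where that interval is
        empty.\<close>
      have "(LINT t:{..x}|lborel. g t) = (LINT t:{- real n<..max (- real n) (min x (real n))}|lborel. f t)"
        unfolding set_lebesgue_integral_def g_def
        by (intro Bochner_Integration.integral_cong) (auto split: split_indicator simp: scaleR_conv_of_real)
      thus ?thesis using 0 by simp
    qed
    have int: "integrable lborel (\<lambda>t. indicator {..x} t *\<^sub>R g t)" for x
      using g by (intro integrable_mult_indicator) auto
    have "AE x in lborel. Re (g x) = 0"
    proof (rule AE_eq_0_if_integral_atMost_0)
      show "(LINT t:{..x}|lborel. Re (g t)) = 0" for x
        using integral_Re[OF int[of x]] g0[of x] by (simp add: set_lebesgue_integral_def)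
    qed (use g in auto)
    moreover have "AE x in lborel. Im (g x) = 0"
    proof (rule AE_eq_0_if_integral_atMost_0)
      show "(LINT t:{..x}|lborel. Im (g t)) = 0" for x
        using integral_Im[OF int[of x]] g0[of x] by (simp add: set_lebesgue_integral_def)
    qed (use g in auto)
    ultimately show "AE x in lborel. Re (indicator {- real n<..real n} x * f x) = 0 \<and>
                                 Im (indicator {- real n<..real n} x * f x) = 0"
      unfolding g_def by eventually_elim auto
  qed
  thus ?thesis
  proof eventually_elim
    case (elim x)
    obtain n :: nat where "\<bar>x\<bar> < real n" using reals_Archimedean2 by blast
    hence "x \<in> {- real n<..real n}" by auto
    thus ?case using elim[rule_format, of n] by (simp add: complex_eq_iff)
  qed
qed

text \<open>For nonzero \<open>t\<close> this is the integral of \<open>cis (- (t * x))\<close> over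
  \<open>x\<close> from \<open>a\<close> to \<open>b\<close>, the kernel in Levy's inversion
  formula. At \<open>t = 0\<close> division by zero gives \<open>0\<close> instead of
  \<open>b - a\<close>, which concerns only a null set.\<close>

definition levy_kernel :: "real \<Rightarrow> real \<Rightarrow> real \<Rightarrow> complex" where
  "levy_kernel a b t = (cis (- (t * a)) - cis (- (t * b))) / (\<i> * t)"

lemma norm_levy_kernel_le: "a \<le> b \<Longrightarrow> norm (levy_kernel a b t) \<le> b - a"
  using Levy_Inversion_aux2[of "-b" "-a" t]
  by (cases "t = 0") (simp_all add: levy_kernel_def cis_conv_exp)

lemma borel_measurable_levy_kernel [measurable]: "levy_kernel a b \<in> borel_measurable borel"
  unfolding levy_kernel_def[abs_def] by measurable

lemma integrable_levy_kernel:
  assumes [measurable]: "u \<in> borel_measurable borel" and u: "\<And>t. norm (u t) \<le> C" and "a \<le> b"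
  shows "integrable lborel (\<lambda>t. indicator {- real T..real T} t * (levy_kernel a b t * u t))"
proof (rule Bochner_Integration.integrable_bound)
  show "integrable lborel (\<lambda>t. indicator {- real T..real T} t *\<^sub>R ((b - a) * C))"
    by simp
  show "AE t in lborel. norm (indicator {- real T..real T} t * (levy_kernel a b t * u t))
          \<le> norm (indicator {- real T..real T} t *\<^sub>R ((b - a) * C))"
  proof (intro AE_I2)
    fix t
    have "norm (levy_kernel a b t * u t) \<le> (b - a) * C"
      unfolding norm_mult by (intro mult_mono norm_levy_kernel_le u) (use assms in auto)
    thus "norm (indicator {- real T..real T} t * (levy_kernel a b t * u t))
          \<le> norm (indicator {- real T..real T} t *\<^sub>R ((b - a) * C))"
      by (auto split: split_indicator)
  qed
qed measurable

text \<open>Levy's inversion formula, made a predicate so that it can be carried by linearity from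
  probability densities to all integrable functions. The argument \<open>- t\<close> appears because
  characteristic functions have the opposite sign in the exponent.\<close>

definition levy_inverts :: "real \<Rightarrow> real \<Rightarrow> (real \<Rightarrow> complex) \<Rightarrow> bool" where
  "levy_inverts a b f \<longleftrightarrow>
     (\<lambda>T. LINT t|lborel. indicator {- real T..real T} t * (levy_kernel a b t * fourier f (- t)))
       \<longlonglongrightarrow> complex_of_real (2 * pi) * (LINT t:{a<..b}|lborel. f t)"

lemma integrable_levy_kernel_fourier:
  assumes f: "integrable lborel f" and "a \<le> b"
  shows "integrable lborel
    (\<lambda>t. indicator {- real T..real T} t * (levy_kernel a b t * fourier f (- t)))"
proof (rule integrable_levy_kernel)
  have [measurable]: "f \<in> borel_measurable borel" using f by auto
  show "(\<lambda>t. fourier f (- t)) \<in> borel_measurable borel" by measurable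
qed (use norm_fourier_le assms in auto)

lemma levy_inverts_diff:
  assumes "a \<le> b" and f: "integrable lborel f" "levy_inverts a b f"
    and g: "integrable lborel g" "levy_inverts a b g"
  shows "levy_inverts a b (\<lambda>x. f x - g x)"
proof -
  have "(LINT t:{a<..b}|lborel. f t - g t) = (LINT t:{a<..b}|lborel. f t) - (LINT t:{a<..b}|lborel. g t)"
    using f g by (intro set_integral_diff set_integrable_lborelI) auto
  moreover have "(\<lambda>T. LINT t|lborel. indicator {- real T..real T} t * (levy_kernel a b t * fourier (\<lambda>x. f x - g x) (- t)))
     = (\<lambda>T. (LINT t|lborel. indicator {- real T..real T} t * (levy_kernel a b t * fourier f (- t)))
         - (LINT t|lborel. indicator {- real T..real T} t * (levy_kernel a b t * fourier g (- t))))"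
    using f g \<open>a \<le> b\<close>
    by (subst Bochner_Integration.integral_diff[symmetric])
       (auto simp: integrable_levy_kernel_fourier fourier_diff ring_distribs)
  ultimately show ?thesis
    using tendsto_diff[OF f(2)[unfolded levy_inverts_def] g(2)[unfolded levy_inverts_def]]
    by (simp add: levy_inverts_def ring_distribs)
qed

lemma levy_inverts_cmult:
  assumes "levy_inverts a b f"
  shows "levy_inverts a b (\<lambda>x. c * f x)"
proof -
  have F: "fourier (\<lambda>x. c * f x) t = c * fourier f t" for t
    by (simp only: fourier_cis mult.left_commute[of _ c] integral_mult_right_zero)
  have *: "(LINT t|lborel. indicator {- real T..real T} t * (levy_kernel a b t * fourier (\<lambda>x. c * f x) (- t)))
    = c * (LINT t|lborel. indicator {- real T..real T} t * (levy_kernel a b t * fourier f (- t)))" for T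
    by (simp only: F mult.left_commute[of _ c] integral_mult_right_zero)
  show ?thesis
    using tendsto_mult_left[OF assms[unfolded levy_inverts_def], of c]
    unfolding levy_inverts_def * by (simp add: mult_ac)
qed

text \<open>If the integral \<open>c\<close> is positive, \<open>f\<close> is \<open>c\<close> times
  a probability density, to which Levy's theorem for characteristic functions applies; if it is
  zero, both sides of the formula vanish.\<close>

lemma levy_inverts_nonneg:
  fixes f :: "real \<Rightarrow> real"
  assumes f: "integrable lborel f" and nonneg: "\<And>x. 0 \<le> f x" and "a \<le> b"
  shows "levy_inverts a b (\<lambda>x. of_real (f x))"
proof (cases "integral\<^sup>L lborel f = 0")
  case True
  hence ae: "AE x in lborel. f x = 0"
    using integral_nonneg_eq_0_iff_AE[OF f] nonneg by simp
  have [measurable]: "f \<in> borel_measurable borel" using f by auto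
  have "fourier (\<lambda>x. of_real (f x)) = fourier (\<lambda>x. 0)"
    by (rule fourier_cong_AE) (use ae in auto)
  hence "fourier (\<lambda>x. of_real (f x)) t = 0" for t by (simp add: fourier_cis)
  moreover have "(LINT t:{a<..b}|lborel. complex_of_real (f t)) = (LINT t:{a<..b}|lborel. 0)"
    by (rule set_lebesgue_integral_cong_AE) (use ae in auto)
  hence "(LINT t:{a<..b}|lborel. complex_of_real (f t)) = 0"
    by (simp add: set_lebesgue_integral_def)
  ultimately show ?thesis
    by (simp add: levy_inverts_def)
next
  case False
  define c where "c = integral\<^sup>L lborel f"
  have c: "c > 0"
    using False Bochner_Integration.integral_nonneg[of lborel f] nonneg by (simp add: c_def order_less_le)
  have [measurable]: "f \<in> borel_measurable borel" using f by auto
  define M where "M = density lborel (\<lambda>x. ennreal (f x / c))"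
  have meas: "emeasure M A = ennreal (LINT x:A|lborel. f x / c)" if "A \<in> sets borel" for A
  proof -
    have "emeasure M A = (\<integral>\<^sup>+t. ennreal (indicator A t * (f t / c)) \<partial>lborel)"
      unfolding M_def using that
      by (subst emeasure_density) (auto intro!: nn_integral_cong split: split_indicator)
    also have "\<dots> = ennreal (LINT x:A|lborel. f x / c)"
      unfolding set_lebesgue_integral_def
      using f nonneg c that integrable_mult_indicator[of A lborel "\<lambda>x. f x / c"]
      by (subst nn_integral_eq_integral) auto
    finally show ?thesis .
  qed
  have m: "measure M A = (LINT x:A|lborel. f x / c)" if "A \<in> sets borel" for A
    unfolding measure_def meas[OF that] set_lebesgue_integral_def
    using nonneg c by (simp add: integral_nonneg_AE)
  have "emeasure M UNIV = 1"
    using c by (subst meas) (simp_all add: set_lebesgue_integral_def c_def)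
  hence "prob_space M" by (intro prob_spaceI) (simp add: M_def)
  then interpret M: real_distribution M
    by (auto simp: real_distribution_def real_distribution_axioms_def M_def)
  have char: "char M t = fourier (\<lambda>x. of_real (f x)) (- t) / c" for t
  proof -
    have "char M t = (LINT x|lborel. (f x / c) *\<^sub>R cis (t * x))"
      unfolding char_def M_def cis_conv_exp using nonneg c by (subst integral_density) auto
    also have "\<dots> = (LINT x|lborel. 1 / c * (cis (- (- t * x)) * of_real (f x)))"
      by (simp add: scaleR_conv_of_real mult_ac)
    finally show ?thesis
      unfolding fourier_cis integral_mult_right_zero by simp
  qed
  \<comment> \<open>Levy's theorem for distributions requires end points that are not atoms.\<close>
  have pt: "measure M {x} = 0" for x
  proof -
    have ae: "AE t in lborel. t \<in> {x} \<longrightarrow> f t / c = 0"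
      using AE_lborel_singleton[of x] by eventually_elim auto
    have "(LINT t:{x}|lborel. f t / c) = (LINT t:{x}|lborel. 0)"
      by (intro set_lebesgue_integral_cong_AE ae) auto
    thus ?thesis by (simp add: m set_lebesgue_integral_def)
  qed
  note L = M.Levy_Inversion[OF \<open>a \<le> b\<close> pt pt]
  have eq: "(CLBINT t=-real T..real T. (iexp (-(t * a)) - iexp (-(t * b))) / (\<i> * t) * char M t)
      = 1 / c * (LINT t|lborel. indicator {- real T..real T} t * (levy_kernel a b t * fourier (\<lambda>x. of_real (f x)) (- t)))" for T
    unfolding integral_mult_right_zero[symmetric]
    by (subst interval_integral_Icc)
       (auto simp: set_lebesgue_integral_def char levy_kernel_def cis_conv_exp scaleR_conv_of_real
             of_real_indicator mult_ac intro!: Bochner_Integration.integral_cong)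
  have "(\<lambda>T. (LINT t|lborel. indicator {- real T..real T} t * (levy_kernel a b t * fourier (\<lambda>x. of_real (f x)) (- t)))
      / (complex_of_real c * (2 * complex_of_real pi))) \<longlonglongrightarrow> complex_of_real (measure M {a<..b})"
    using L eq by simp
  from tendsto_mult_left[OF this, of "complex_of_real c * (2 * complex_of_real pi)"] c
  have "(\<lambda>T. LINT t|lborel. indicator {- real T..real T} t * (levy_kernel a b t * fourier (\<lambda>x. of_real (f x)) (- t)))
     \<longlonglongrightarrow> complex_of_real (2 * pi) * c * complex_of_real (measure M {a<..b})" by (simp add: mult_ac)
  moreover have "c * measure M {a<..b} = (LINT t:{a<..b}|lborel. f t)"
    using c by (simp add: m set_lebesgue_integral_def)
  hence "c * complex_of_real (measure M {a<..b}) = (LINT t:{a<..b}|lborel. of_real (f t))"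
    by (simp only: set_integral_complex_of_real of_real_mult[symmetric])
  ultimately show ?thesis by (simp add: levy_inverts_def mult.assoc)
qed

lemma levy_inverts:
  assumes f: "integrable lborel f" and ab: "a \<le> b"
  shows "levy_inverts a b f"
proof -
  have real: "levy_inverts a b (\<lambda>x. complex_of_real (g x))" if g: "integrable lborel g" for g
  proof -
    have "levy_inverts a b (\<lambda>x. complex_of_real (max 0 (g x)) - complex_of_real (max 0 (- g x)))"
      by (intro levy_inverts_diff levy_inverts_nonneg) (use g ab in auto)
    also have "(\<lambda>x. complex_of_real (max 0 (g x)) - complex_of_real (max 0 (- g x))) = (\<lambda>x. complex_of_real (g x))"
      by (auto simp: max_def)
    finally show ?thesis .
  qed
  \<comment> \<open>The sum is written as a difference because closure was shown for differences and
    scalar multiples.\<close>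
  have "levy_inverts a b (\<lambda>x. complex_of_real (Re (f x)) - (- \<i>) * complex_of_real (Im (f x)))"
    by (intro levy_inverts_diff levy_inverts_cmult real) (use f ab in auto)
  also have "(\<lambda>x. complex_of_real (Re (f x)) - (- \<i>) * complex_of_real (Im (f x))) = f"
    by (auto simp: complex_eq_iff)
  finally show ?thesis .
qed

section \<open>The inversion theorem\<close>

lemma fourier_inv_eq_fourier: "fourier_inv \<psi> x = 1 / (2 * pi) * fourier \<psi> (- x)"
  by (simp add: fourier_inv_def fourier_cis mult.commute)

lemma norm_cis_diff_le: "norm (cis a - cis b) \<le> \<bar>a - b\<bar>"
proof -
  have "norm (cis a - cis b) = norm (cis b * (cis (a - b) - 1))"
    by (simp add: ring_distribs cis_mult)
  also have "\<dots> \<le> \<bar>a - b\<bar>"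
    using iexp_approx1[of "a - b" 0] by (simp add: norm_mult cis_conv_exp)
  finally show ?thesis .
qed

lemma set_integral_cis:
  assumes "\<omega> \<noteq> 0" "a \<le> b"
  shows "(LINT x:{a<..b}|lborel. cis (\<omega> * x)) = (cis (\<omega> * b) - cis (\<omega> * a)) / (\<i> * \<omega>)"
proof -
  have "(LINT x:{a<..b}|lborel. cis (\<omega> * x)) = (LINT x:{a..b}|lborel. cis (\<omega> * x))"
    unfolding set_lebesgue_integral_def
    by (intro integral_cong_AE)
       (use AE_lborel_singleton[of a] in \<open>auto split: split_indicator elim!: eventually_mono\<close>)
  also have "\<dots> = integral {a..b} (\<lambda>x. cis (\<omega> * x))"
    by (intro set_borel_integral_eq_integral borel_integrable_atLeastAtMost')
       (auto intro!: continuous_intros)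
  also have "\<dots> = cis (\<omega> * b) / (\<i> * \<omega>) - cis (\<omega> * a) / (\<i> * \<omega>)"
  proof (intro integral_unique fundamental_theorem_of_calculus)
    fix x
    have "((\<lambda>x. exp (\<i> * (of_real \<omega> * of_real x)) / (\<i> * \<omega>)) has_vector_derivative cis (\<omega> * x)) (at x within {a..b})"
      by (rule has_vector_derivative_real_field)
         (use assms in \<open>auto intro!: derivative_eq_intros simp: cis_conv_exp field_simps\<close>)
    thus "((\<lambda>x. cis (\<omega> * x) / (\<i> * \<omega>)) has_vector_derivative cis (\<omega> * x)) (at x within {a..b})"
      by (simp add: cis_conv_exp)
  qed (use assms in auto)
  finally show ?thesis by (simp add: diff_divide_distrib)
qed

text \<open>Fubini on \<open>{a<..b}\<close> times the line: integrating in \<open>x\<close> first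
  turns the exponential into the Levy kernel, up to a reflection of the frequency that the last
  substitution undoes.\<close>

lemma integral_fourier_inv_interval:
  assumes \<psi>: "integrable lborel \<psi>" and "a \<le> b"
  shows "set_integrable lborel {a<..b} (fourier_inv \<psi>)"
    and "2 * pi * (LINT x:{a<..b}|lborel. fourier_inv \<psi> x) = (LINT t|lborel. levy_kernel a b t * \<psi> (- t))"
proof -
  have [measurable]: "\<psi> \<in> borel_measurable borel" using \<psi> by auto
  have fin: "integrable lborel (indicator {a<..b} :: real \<Rightarrow> real)"
    using \<open>a \<le> b\<close> by (intro integrable_real_indicator) auto
  have *: "integrable (lborel \<Otimes>\<^sub>M lborel) (\<lambda>(x, \<omega>). indicator {a<..b} x *\<^sub>R (cis (\<omega> * x) * \<psi> \<omega>))"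
  proof (rule lborel_pair.Fubini_integrable)
    show "integrable lborel (\<lambda>x. LINT \<omega>|lborel. norm (case (x, \<omega>) of (x, \<omega>) \<Rightarrow> indicator {a<..b} x *\<^sub>R (cis (\<omega> * x) * \<psi> \<omega>)))"
      using fin by (simp add: norm_mult)
    show "AE x in lborel. integrable lborel (\<lambda>\<omega>. case (x, \<omega>) of (x, \<omega>) \<Rightarrow> indicator {a<..b} x *\<^sub>R (cis (\<omega> * x) * \<psi> \<omega>))"
      by (auto intro!: integrable_scaleR_right integrable_cis_mult \<psi>)
  qed measurable
  from lborel_pair.integrable_fst'[OF *]
  have "integrable lborel (\<lambda>x. indicator {a<..b} x *\<^sub>R (LINT \<omega>|lborel. cis (\<omega> * x) * \<psi> \<omega>))"
    by (simp only: prod.case integral_scaleR_right)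
  from integrable_mult_right[OF this, of "1 / (2 * pi)"]
  show "set_integrable lborel {a<..b} (fourier_inv \<psi>)"
    by (simp add: set_integrable_def fourier_inv_def[abs_def] mult_ac scaleR_conv_of_real)
  have "2 * pi * (LINT x:{a<..b}|lborel. fourier_inv \<psi> x) =
     (LINT x:{a<..b}|lborel. 2 * pi * fourier_inv \<psi> x)"
    by (simp only: set_integral_mult_right)
  also have "\<dots> = (LINT x|lborel. LINT \<omega>|lborel. indicator {a<..b} x *\<^sub>R (cis (\<omega> * x) * \<psi> \<omega>))"
    by (simp add: set_lebesgue_integral_def fourier_inv_def)
  also have "\<dots> = (LINT \<omega>|lborel. LINT x|lborel. indicator {a<..b} x *\<^sub>R (cis (\<omega> * x) * \<psi> \<omega>))"
    using lborel_pair.Fubini_integral[OF *] by simp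
  also have "\<dots> = (LINT \<omega>|lborel. (LINT x:{a<..b}|lborel. cis (\<omega> * x)) * \<psi> \<omega>)"
    unfolding set_lebesgue_integral_def mult_scaleR_left[symmetric] integral_mult_left_zero ..
  also have "\<dots> = (LINT \<omega>|lborel. levy_kernel a b (- \<omega>) * \<psi> \<omega>)"
  proof (rule integral_cong_AE)
    have "AE \<omega> in lborel. \<omega> \<noteq> (0::real)" by (rule AE_lborel_singleton)
    thus "AE \<omega> in lborel. (LINT x:{a<..b}|lborel. cis (\<omega> * x)) * \<psi> \<omega> = levy_kernel a b (- \<omega>) * \<psi> \<omega>"
    proof eventually_elim
      case (elim \<omega>)
      thus ?case
        using \<open>a \<le> b\<close> by (subst set_integral_cis) (auto simp: levy_kernel_def field_simps)
    qed
  qed (unfold set_lebesgue_integral_def, measurable)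
  also have "\<dots> = (LINT t|lborel. levy_kernel a b t * \<psi> (- t))"
    using lborel_integral_real_affine[of "-1" "\<lambda>\<omega>. levy_kernel a b (- \<omega>) * \<psi> \<omega>" 0] by simp
  finally show "2 * pi * (LINT x:{a<..b}|lborel. fourier_inv \<psi> x) = (LINT t|lborel. levy_kernel a b t * \<psi> (- t))" .
qed

text \<open>Integrals over intervals determine both sides almost everywhere. For \<open>f\<close>
  they are limits of truncated integrals against the Levy kernel; since \<open>fourier f\<close> is
  integrable, dominated convergence gives the full integral, which belongs to the interval integral
  of the inverse transform.\<close>

theorem fourier_inversion:
  assumes f: "integrable lborel f" and F: "integrable lborel (fourier f)"
  shows "AE x in lborel. f x = fourier_inv (fourier f) x"
proof -
  have si: "set_integrable lborel {a<..b} f" for a b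
    using f by (rule set_integrable_lborelI) simp
  have si': "set_integrable lborel {a<..b} (fourier_inv (fourier f))" for a b
    using integral_fourier_inv_interval(1)[OF F, of a b]
    by (cases "a \<le> b") (auto simp: set_integrable_def)
  have [measurable]: "f \<in> borel_measurable borel" using f by auto
  have "AE x in lborel. f x - fourier_inv (fourier f) x = 0"
  proof (rule AE_eq_0_if_interval_integrals_0)
    fix a b :: real assume ab: "a \<le> b"
    let ?g = "\<lambda>t. levy_kernel a b t * fourier f (- t)"
    have "(\<lambda>T. LINT t|lborel. indicator {- real T..real T} t * ?g t) \<longlonglongrightarrow> (LINT t|lborel. ?g t)"
    proof (rule integral_dominated_convergence)
      show "integrable lborel (\<lambda>t. (b - a) * norm (fourier f (- t)))"
        using lborel_integrable_real_affine[OF F, of "-1" 0] by simp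
      show "AE t in lborel. (\<lambda>T. indicator {- real T..real T} t * ?g t) \<longlonglongrightarrow> ?g t"
      proof (intro AE_I2 tendsto_eventually)
        fix t :: real
        obtain n :: nat where n: "\<bar>t\<bar> < real n" using reals_Archimedean2 by blast
        show "\<forall>\<^sub>F T in sequentially. indicator {- real T..real T} t * ?g t = ?g t"
          using eventually_ge_at_top[of n]
        proof eventually_elim
          case (elim T)
          hence "t \<in> {- real T..real T}" using n by auto
          thus ?case by simp
        qed
      qed
      show "AE t in lborel. norm (indicator {- real T..real T} t * ?g t) \<le> (b - a) * norm (fourier f (- t))" for T
        using norm_levy_kernel_le[OF ab] ab
        by (auto split: split_indicator simp: norm_mult intro!: mult_right_mono)
    qed measurable
    from LIMSEQ_unique[OF this levy_inverts[OF f ab, unfolded levy_inverts_def]]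
    have "complex_of_real (2 * pi) * (LINT t:{a<..b}|lborel. f t) = complex_of_real (2 * pi) * (LINT x:{a<..b}|lborel. fourier_inv (fourier f) x)"
      using integral_fourier_inv_interval(2)[OF F ab] by simp
    thus "(LINT t:{a<..b}|lborel. f t - fourier_inv (fourier f) t) = 0"
      by (simp add: set_integral_diff[OF si si'])
  qed (use set_integral_diff(1)[OF si si'] in auto)
  thus ?thesis by eventually_elim simp
qed

section \<open>Continuity and derivatives of inverse transforms\<close>

lemma continuous_fourier_inv:
  assumes \<psi>: "integrable lborel \<psi>"
  shows "continuous_on UNIV (fourier_inv \<psi>)"
proof (intro continuous_at_imp_continuous_on ballI)
  fix x :: real
  have [measurable]: "\<psi> \<in> borel_measurable borel" using \<psi> by auto
  show "isCont (fourier_inv \<psi>) x"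
    unfolding continuous_at_sequentially o_def
  proof (intro allI impI)
    fix X :: "nat \<Rightarrow> real" assume X: "X \<longlonglongrightarrow> x"
    have "(\<lambda>n. LINT \<omega>|lborel. cis (\<omega> * X n) * \<psi> \<omega>) \<longlonglongrightarrow> (LINT \<omega>|lborel. cis (\<omega> * x) * \<psi> \<omega>)"
      by (rule integral_dominated_convergence[where w = "\<lambda>\<omega>. norm (\<psi> \<omega>)"])
         (use \<psi> X in \<open>auto simp: norm_mult intro!: tendsto_intros\<close>)
    thus "(\<lambda>n. fourier_inv \<psi> (X n)) \<longlonglongrightarrow> fourier_inv \<psi> x"
      unfolding fourier_inv_def by (intro tendsto_intros)
  qed
qed

text \<open>The points of agreement form a closed set of full measure, and such a set is the whole
  line.\<close>

lemma fourier_inversion_continuous: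
  assumes "integrable lborel f" "integrable lborel (fourier f)" "continuous_on UNIV f"
  shows "f = fourier_inv (fourier f)"
proof
  fix x
  have "closed {x. f x = fourier_inv (fourier f) x}"
    using assms by (intro closed_Collect_eq continuous_fourier_inv)
  moreover have "AE x in lebesgue. f x = fourier_inv (fourier f) x"
    using fourier_inversion[OF assms(1,2)] by (rule AE_completion)
  ultimately show "f x = fourier_inv (fourier f) x"
    using mem_closed_if_AE_lebesgue[of "{x. f x = fourier_inv (fourier f) x}" x] by simp
qed

lemma has_vector_derivative_at_iff_slope:
  fixes f :: "real \<Rightarrow> 'a :: real_normed_vector"
  shows "(f has_vector_derivative D) (at x) \<longleftrightarrow> ((\<lambda>y. (f y - f x) /\<^sub>R (y - x)) \<longlongrightarrow> D) (at x)"
proof -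
  have "(f has_vector_derivative D) (at x) \<longleftrightarrow>
      ((\<lambda>y. norm (f y - f x - (y - x) *\<^sub>R D) / norm (y - x)) \<longlongrightarrow> 0) (at x)"
    by (simp add: has_vector_derivative_def has_derivative_iff_norm bounded_linear_scaleR_left)
  also have "\<dots> \<longleftrightarrow> ((\<lambda>y. norm ((f y - f x) /\<^sub>R (y - x) - D)) \<longlongrightarrow> 0) (at x)"
  proof (intro filterlim_cong refl)
    show "\<forall>\<^sub>F y in at x. norm (f y - f x - (y - x) *\<^sub>R D) / norm (y - x) = norm ((f y - f x) /\<^sub>R (y - x) - D)"
      using eventually_neq_at_within[of x x UNIV]
    proof eventually_elim
      case (elim y)
      have "(f y - f x) /\<^sub>R (y - x) - D = (f y - f x - (y - x) *\<^sub>R D) /\<^sub>R (y - x)"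
        using elim by (simp add: scaleR_diff_right)
      thus ?case by (simp add: divide_inverse mult.commute)
    qed
  qed
  finally show ?thesis
    by (simp add: tendsto_norm_zero_iff LIM_zero_iff)
qed

lemma norm_fourier_inv_le:
  "norm (fourier_inv \<psi> x) \<le> 1 / (2 * pi) * (LINT \<omega>|lborel. norm (\<psi> \<omega>))"
  unfolding fourier_inv_def norm_mult
  by (intro mult_mono order_trans[OF integral_norm_bound])
     (simp_all add: norm_mult norm_divide)

text \<open>Dominated convergence for difference quotients: by \<open>norm_cis_diff_le\<close> those
  of \<open>cis (\<omega> * x)\<close> are bounded by \<open>\<bar>\<omega>\<bar>\<close>, so
  \<open>norm (\<i> * \<omega> * \<psi> \<omega>)\<close> is a majorant independent of the
  step.\<close>

lemma has_vector_derivative_fourier_inv: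
  fixes \<psi> :: "real \<Rightarrow> complex"
  assumes \<psi>: "integrable lborel \<psi>" and \<psi>': "integrable lborel (\<lambda>\<omega>. \<i> * \<omega> * \<psi> \<omega>)"
  shows "(fourier_inv \<psi> has_vector_derivative fourier_inv (\<lambda>\<omega>. \<i> * \<omega> * \<psi> \<omega>) x) (at x)"
proof -
  have [measurable]: "\<psi> \<in> borel_measurable borel" using \<psi> by auto
  let ?q = "\<lambda>y \<omega>. (cis (\<omega> * y) - cis (\<omega> * x)) / (y - x)"
  have "((\<lambda>y. LINT \<omega>|lborel. ?q y \<omega> * \<psi> \<omega>) \<longlongrightarrow> (LINT \<omega>|lborel. cis (\<omega> * x) * (\<i> * \<omega> * \<psi> \<omega>))) (at x)"
    unfolding tendsto_at_iff_sequentially o_def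
  proof (intro allI impI)
    fix X :: "nat \<Rightarrow> real" assume X: "\<forall>i. X i \<in> UNIV - {x}" "X \<longlonglongrightarrow> x"
    show "(\<lambda>n. LINT \<omega>|lborel. ?q (X n) \<omega> * \<psi> \<omega>) \<longlonglongrightarrow> (LINT \<omega>|lborel. cis (\<omega> * x) * (\<i> * \<omega> * \<psi> \<omega>))"
    proof (rule integral_dominated_convergence[where w = "\<lambda>\<omega>. norm (\<i> * \<omega> * \<psi> \<omega>)"])
      show "AE \<omega> in lborel. (\<lambda>n. ?q (X n) \<omega> * \<psi> \<omega>) \<longlonglongrightarrow> cis (\<omega> * x) * (\<i> * \<omega> * \<psi> \<omega>)"
      proof (intro AE_I2)
        fix \<omega> :: real
        have "((\<lambda>x. exp (\<i> * (of_real \<omega> * of_real x))) has_vector_derivative \<i> * \<omega> * cis (\<omega> * x)) (at x)"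
          by (rule has_vector_derivative_real_field)
             (auto intro!: derivative_eq_intros simp: cis_conv_exp field_simps)
        hence "((\<lambda>x. cis (\<omega> * x)) has_vector_derivative \<i> * \<omega> * cis (\<omega> * x)) (at x)"
          by (simp add: cis_conv_exp)
        hence "((\<lambda>y. ?q y \<omega>) \<longlongrightarrow> \<i> * \<omega> * cis (\<omega> * x)) (at x)"
          by (simp add: has_vector_derivative_at_iff_slope scaleR_conv_of_real divide_inverse mult_ac)
        hence "(\<lambda>n. ?q (X n) \<omega>) \<longlonglongrightarrow> \<i> * \<omega> * cis (\<omega> * x)"
          using X unfolding tendsto_at_iff_sequentially o_def by blast
        from tendsto_mult_right[OF this, of "\<psi> \<omega>"]
        show "(\<lambda>n. ?q (X n) \<omega> * \<psi> \<omega>) \<longlonglongrightarrow> cis (\<omega> * x) * (\<i> * \<omega> * \<psi> \<omega>)"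
          by (simp add: mult_ac)
      qed
      show "AE \<omega> in lborel. norm (?q (X n) \<omega> * \<psi> \<omega>) \<le> norm (\<i> * \<omega> * \<psi> \<omega>)" for n
      proof (intro AE_I2)
        fix \<omega> :: real
        have "norm (?q (X n) \<omega>) \<le> \<bar>\<omega> * X n - \<omega> * x\<bar> / \<bar>X n - x\<bar>"
          unfolding norm_divide norm_of_real
          by (intro divide_right_mono norm_cis_diff_le) (simp flip: of_real_diff)
        also have "\<omega> * X n - \<omega> * x = \<omega> * (X n - x)"
          by (simp add: ring_distribs)
        also have "\<bar>\<dots>\<bar> / \<bar>X n - x\<bar> = \<bar>\<omega>\<bar>"
          using X(1)[rule_format, of n] by (simp add: abs_mult)
        finally show "norm (?q (X n) \<omega> * \<psi> \<omega>) \<le> norm (\<i> * \<omega> * \<psi> \<omega>)"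
          unfolding norm_mult[of "?q (X n) \<omega>"] by (simp add: norm_mult mult_right_mono)
      qed
    qed (use \<psi>' in \<open>auto intro: integrable_norm\<close>)
  qed
  from tendsto_mult_left[OF this, of "1 / (2 * pi)"]
  have lim: "((\<lambda>y. 1 / (2 * pi) * (LINT \<omega>|lborel. ?q y \<omega> * \<psi> \<omega>)) \<longlongrightarrow> fourier_inv (\<lambda>\<omega>. \<i> * \<omega> * \<psi> \<omega>) x) (at x)"
    by (simp only: fourier_inv_def)
  have "1 / (2 * pi) * (LINT \<omega>|lborel. ?q y \<omega> * \<psi> \<omega>) = (fourier_inv \<psi> y - fourier_inv \<psi> x) /\<^sub>R (y - x)" for y
  proof -
    have "(LINT \<omega>|lborel. ?q y \<omega> * \<psi> \<omega>) = (LINT \<omega>|lborel. (cis (\<omega> * y) * \<psi> \<omega> - cis (\<omega> * x) * \<psi> \<omega>) / (y - x))"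
      by (simp add: algebra_simps diff_divide_distrib)
    also have "\<dots> = ((LINT \<omega>|lborel. cis (\<omega> * y) * \<psi> \<omega>) - (LINT \<omega>|lborel. cis (\<omega> * x) * \<psi> \<omega>)) / (y - x)"
      unfolding integral_divide_zero
      by (subst Bochner_Integration.integral_diff) (auto intro!: integrable_cis_mult \<psi>)
    finally show ?thesis
      by (simp add: fourier_inv_def scaleR_conv_of_real field_simps)
  qed
  with lim show ?thesis
    unfolding has_vector_derivative_at_iff_slope by simp
qed

section \<open>Backward differences and derivatives\<close>

definition bdiff :: "real \<Rightarrow> (real \<Rightarrow> complex) \<Rightarrow> real \<Rightarrow> complex" where
  "bdiff h f x = f x - f (x - h)"

lemma integrable_bdiff: "integrable lborel f \<Longrightarrow> integrable lborel (bdiff h f)"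
  unfolding bdiff_def[abs_def] by (intro Bochner_Integration.integrable_diff integrable_shift)

lemma fourier_bdiff:
  "integrable lborel f \<Longrightarrow> fourier (bdiff h f) \<omega> = (1 - cis (- (\<omega> * h))) * fourier f \<omega>"
  unfolding bdiff_def[abs_def]
  by (subst fourier_diff) (auto intro!: integrable_shift simp: fourier_shift ring_distribs)

lemma fourier_bdiff_funpow:
  assumes "integrable lborel f"
  shows "integrable lborel ((bdiff h ^^ m) f) \<and>
         fourier ((bdiff h ^^ m) f) \<omega> = (1 - cis (- (\<omega> * h))) ^ m * fourier f \<omega>"
  by (induction m) (use assms in \<open>auto simp: integrable_bdiff fourier_bdiff mult_ac\<close>)

text \<open>\<open>bdiff h F\<close> is the convolution of \<open>f\<close> with the indicator of
  \<open>{0<..h}\<close>, so it is integrable even if \<open>F\<close> is not. For nonzero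
  \<open>\<omega>\<close> the indicator has transform
  \<open>(1 - cis (- (\<omega> * h))) / (\<i> * \<omega>)\<close>; the identity is multiplied out to
  include \<open>\<omega> = 0\<close>.\<close>

lemma fourier_bdiff_derivative:
  assumes F: "\<And>x. (F has_vector_derivative f x) (at x)" and f: "integrable lborel f" and h: "h > 0"
  shows "integrable lborel (bdiff h F)"
    and "fourier (bdiff h F) \<omega> * (\<i> * \<omega>) = (1 - cis (- (\<omega> * h))) * fourier f \<omega>"
proof -
  have [measurable]: "f \<in> borel_measurable borel" using f by auto
  define g :: "real \<Rightarrow> complex" where "g = (\<lambda>t. indicator {0<..h} t)"
  have [measurable]: "g \<in> borel_measurable borel" unfolding g_def by measurable
  have g: "integrable lborel g"
  proof -
    have "integrable lborel (\<lambda>t. complex_of_real (indicator {0<..h} t))"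
      using h by (intro integrable_of_real integrable_real_indicator) auto
    thus ?thesis by (simp add: g_def of_real_indicator)
  qed
  have eq: "bdiff h F = (\<lambda>x. LINT y|lborel. f y * g (x - y))"
  proof
    fix x
    have "(f has_integral F x - F (x - h)) {x - h..x}"
      using h by (intro fundamental_theorem_of_calculus has_vector_derivative_at_within[OF F]) auto
    hence "bdiff h F x = integral {x - h..x} f"
      by (simp add: bdiff_def integral_unique)
    also have "\<dots> = (LINT y:{x - h..x}|lborel. f y)"
      by (intro set_borel_integral_eq_integral(2)[symmetric] set_integrable_lborelI f) auto
    also have "\<dots> = (LINT y|lborel. f y * g (x - y))"
      unfolding set_lebesgue_integral_def
    proof (rule integral_cong_AE)
      show "AE y in lborel. indicator {x - h..x} y *\<^sub>R f y = f y * g (x - y)"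
        using AE_lborel_singleton[of x]
        by eventually_elim (auto simp: g_def split: split_indicator)
    qed measurable
    finally show "bdiff h F x = (LINT y|lborel. f y * g (x - y))" .
  qed
  show "integrable lborel (bdiff h F)"
    unfolding eq by (rule integrable_convolution[OF f g])
  have "fourier g \<omega> * (\<i> * \<omega>) = 1 - cis (- (\<omega> * h))"
  proof (cases "\<omega> = 0")
    case False
    have "fourier g \<omega> = (LINT x:{0<..h}|lborel. cis (- \<omega> * x))"
      by (simp add: fourier_cis g_def set_lebesgue_integral_def scaleR_conv_of_real of_real_indicator mult.commute)
    thus ?thesis
      using False h by (subst (asm) set_integral_cis) (auto simp: field_simps)
  qed auto
  thus "fourier (bdiff h F) \<omega> * (\<i> * \<omega>) = (1 - cis (- (\<omega> * h))) * fourier f \<omega>"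
    unfolding eq fourier_convolution[OF f g] by (simp add: mult_ac)
qed

section \<open>Iterated derivatives and their differences\<close>

lemma nth_deriv_0 [simp]: "nth_deriv 0 f = f"
  by (simp add: nth_deriv_def)

lemma nth_deriv_Suc: "nth_deriv (Suc n) f x = vector_derivative (nth_deriv n f) (at x)"
  by (simp add: nth_deriv_def)

lemma nth_deriv_Suc_inner: "nth_deriv (Suc n) f = nth_deriv n (\<lambda>x. vector_derivative f (at x))"
  unfolding nth_deriv_def funpow_Suc_right by simp

lemma times_differentiable_Suc:
  "times_differentiable (Suc n) f \<longleftrightarrow>
     (\<forall>x. f differentiable (at x)) \<and> times_differentiable n (\<lambda>x. vector_derivative f (at x))"
  unfolding times_differentiable_def All_less_Suc2
  by (simp add: nth_deriv_Suc_inner)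

lemma times_differentiable_mono:
  "times_differentiable n f \<Longrightarrow> m \<le> n \<Longrightarrow> times_differentiable m f"
  by (auto simp: times_differentiable_def)

lemma has_vector_derivative_nth_deriv:
  assumes "times_differentiable n f" "k < n"
  shows "(nth_deriv k f has_vector_derivative nth_deriv (Suc k) f x) (at x)"
  unfolding nth_deriv_Suc
  using assms by (auto simp: times_differentiable_def vector_derivative_works[symmetric])

lemma has_vector_derivative_bdiff:
  assumes "\<And>x. (f has_vector_derivative f' x) (at x)"
  shows "(bdiff h f has_vector_derivative bdiff h f' x) (at x)"
proof -
  have "((\<lambda>x. f (x - h)) has_vector_derivative f' (x - h)) (at x)"
  proof -
    have "((\<lambda>x. x - h) has_real_derivative 1) (at x)"
      by (auto intro!: derivative_eq_intros)
    hence "((\<lambda>x. x - h) has_vector_derivative 1) (at x)"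
      by (simp add: has_real_derivative_iff_has_vector_derivative)
    from vector_diff_chain_at[OF this, of f "f' (x - h)"] assms show ?thesis
      by (simp add: o_def)
  qed
  thus ?thesis
    unfolding bdiff_def[abs_def] by (intro derivative_intros assms)
qed

lemma has_vector_derivative_bdiff_funpow:
  assumes "\<And>x. (f has_vector_derivative f' x) (at x)"
  shows "((bdiff h ^^ m) f has_vector_derivative (bdiff h ^^ m) f' x) (at x)"
  by (induction m arbitrary: x) (auto intro!: assms has_vector_derivative_bdiff)

text \<open>Only the top derivative is assumed integrable. By induction the \<open>m\<close>-fold
  difference of \<open>F'\<close> is integrable; it is the derivative of the \<open>m\<close>-fold
  difference of \<open>F\<close>, so \<open>fourier_bdiff_derivative\<close> makes one further
  difference of the latter integrable.\<close>

lemma fourier_bdiff_nth_deriv: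
  assumes "times_differentiable m F" "integrable lborel (nth_deriv m F)" "h > 0"
  shows "integrable lborel ((bdiff h ^^ m) F) \<and>
    fourier ((bdiff h ^^ m) F) \<omega> * (\<i> * \<omega>) ^ m =
      (1 - cis (- (\<omega> * h))) ^ m * fourier (nth_deriv m F) \<omega>"
  using assms
proof (induction m arbitrary: F)
  case (Suc m F)
  define F' where "F' = (\<lambda>x. vector_derivative F (at x))"
  have "integrable lborel ((bdiff h ^^ m) F') \<and>
    fourier ((bdiff h ^^ m) F') \<omega> * (\<i> * \<omega>) ^ m =
      (1 - cis (- (\<omega> * h))) ^ m * fourier (nth_deriv m F') \<omega>"
    using Suc.prems unfolding F'_def
    by (intro Suc.IH) (auto simp: times_differentiable_Suc nth_deriv_Suc_inner)
  moreover have "((bdiff h ^^ m) F has_vector_derivative (bdiff h ^^ m) F' x) (at x)" for x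
    using Suc.prems(1)
    by (intro has_vector_derivative_bdiff_funpow)
       (auto simp: F'_def times_differentiable_Suc vector_derivative_works[symmetric])
  note * = fourier_bdiff_derivative[OF this _ Suc.prems(3)]
  \<comment> \<open>\<open>A\<close> is the transform of the \<open>Suc m\<close>-fold difference of
    \<open>F\<close>, \<open>B\<close> that of the \<open>m\<close>-fold difference of
    \<open>F'\<close>, \<open>G\<close> that of the top derivative, \<open>w\<close> the difference
    factor and \<open>z\<close> is \<open>\<i> * \<omega>\<close>.\<close>
  moreover have "A * (z * z ^ m) = w * w ^ m * G" if "A * z = w * B" "B * z ^ m = w ^ m * G" for A B G w z :: complex
  proof -
    have "A * (z * z ^ m) = (A * z) * z ^ m" by (simp only: mult.assoc)
    also have "\<dots> = w * (B * z ^ m)" by (simp only: that(1) mult.assoc)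
    also have "\<dots> = w * w ^ m * G" by (simp only: that(2) mult.assoc)
    finally show ?thesis .
  qed
  note this[OF *(2)]
  ultimately show ?case
    by (simp add: nth_deriv_Suc_inner F'_def[symmetric])
qed simp

section \<open>Powers of the frequency\<close>

lemma norm_imaginary_powr:
  "\<omega> \<noteq> 0 \<Longrightarrow> norm ((\<i> * complex_of_real \<omega>) powr complex_of_real a) = \<bar>\<omega>\<bar> powr a"
  by (simp add: powr_def norm_mult)

lemma integrable_abs_powr:
  assumes "\<gamma> > -1"
  shows "integrable lborel (\<lambda>\<omega>. indicator {-1..1} \<omega> * \<bar>\<omega>\<bar> powr \<gamma> :: real)"
proof -
  \<comment> \<open>The Beta integrand with second parameter \<open>1\<close> equals
    \<open>t powr \<gamma>\<close> except at \<open>t = 1\<close>, where its last factor is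
    \<open>0 powr 0 = 0\<close>.\<close>
  have "set_integrable lborel {0..1} (\<lambda>t. t powr (\<gamma> + 1 - 1) * (1 - t) powr (1 - 1))"
    using assms by (intro integrable_Beta) auto
  hence "integrable lborel (\<lambda>t. indicator {0..1} t *\<^sub>R (t powr (\<gamma> + 1 - 1) * (1 - t) powr (1 - 1)))"
    by (simp add: set_integrable_def)
  moreover have "AE t in lborel. indicator {0..1} t *\<^sub>R (t powr (\<gamma> + 1 - 1) * (1 - t) powr (1 - 1)) = 
      indicator {0..1} t * t powr \<gamma>"
    using AE_lborel_singleton[of 1] by eventually_elim (auto split: split_indicator)
  ultimately have *: "integrable lborel (\<lambda>t. indicator {0..1} t * t powr \<gamma> :: real)"
    by (subst (asm) integrable_cong_AE) auto
  have "integrable lborel (\<lambda>t. indicator {0..1} t * t powr \<gamma> + indicator {0..1} (-t) * (-t) powr \<gamma> :: real)"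
    using lborel_integrable_real_affine[OF *, of "-1" 0] * by (intro Bochner_Integration.integrable_add) auto
  moreover have "AE t in lborel. indicator {0..1} t * t powr \<gamma> + indicator {0..1} (-t) * (-t) powr \<gamma>
      = indicator {-1..1} t * \<bar>t\<bar> powr \<gamma>"
    using AE_lborel_singleton[of 0] by eventually_elim (auto split: split_indicator)
  ultimately show ?thesis
    by (subst (asm) integrable_cong_AE) auto
qed

lemma fourier_inv_cong_AE:
  assumes "AE \<omega> in lborel. \<psi> \<omega> = \<phi> \<omega>"
    "\<psi> \<in> borel_measurable borel" "\<phi> \<in> borel_measurable borel"
  shows "fourier_inv \<psi> = fourier_inv \<phi>"
  unfolding fourier_inv_eq_fourier[abs_def] using fourier_cong_AE[OF assms] by simp

lemma fourier_inv_diff: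
  assumes "integrable lborel u" "integrable lborel v"
  shows "fourier_inv (\<lambda>x. u x - v x) \<omega> = fourier_inv u \<omega> - fourier_inv v \<omega>"
  unfolding fourier_inv_eq_fourier by (simp add: fourier_diff assms diff_divide_distrib)

lemma fourier_inv_cis:
  "fourier_inv (\<lambda>\<omega>. cis (\<omega> * h) * \<psi> \<omega>) x = fourier_inv \<psi> (x + h)"
  by (simp add: fourier_inv_def mult.assoc[symmetric] cis_mult ring_distribs)

text \<open>On the imaginary axis the principal logarithm is explicit,
  \<open>ln \<bar>\<omega>\<bar>\<close> plus or minus \<open>\<i> * pi / 2\<close>, so the power is
  a measurable expression with a case distinction on the sign of \<open>\<omega>\<close>.\<close>

lemma borel_measurable_imaginary_powr [measurable]:
  "(\<lambda>\<omega>. (\<i> * complex_of_real \<omega>) powr a) \<in> borel_measurable borel"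
proof -
  have "(\<i> * complex_of_real \<omega>) powr a = (if \<omega> = 0 then 0
      else exp (a * (of_real (ln \<bar>\<omega>\<bar>) + \<i> * of_real (if \<omega> > 0 then pi / 2 else - pi / 2))))" for \<omega>
  proof (cases "\<omega> = 0")
    case False
    have "Ln (\<i> * complex_of_real \<omega>) = Ln (of_real \<bar>\<omega>\<bar> * (if \<omega> > 0 then \<i> else - \<i>))"
      by (simp add: mult.commute)
    also have "\<dots> = of_real (ln \<bar>\<omega>\<bar>) + \<i> * of_real (if \<omega> > 0 then pi / 2 else - pi / 2)"
    proof (cases "\<omega> > 0")
      case True
      thus ?thesis by (subst Ln_times_of_real) (auto simp: Ln_of_real)
    next
      case neg: False
      with False have "-\<omega> > 0" by simp
      thus ?thesis using neg Ln_of_real[of "- \<omega>"] by (subst Ln_times_of_real) auto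
    qed
    finally show ?thesis using False by (simp add: powr_def)
  qed auto
  thus ?thesis by simp
qed

text \<open>One setting for both kinds of order: \<open>F = u\<close>, \<open>\<sigma> = 0\<close>,
  \<open>c = 1\<close> for integer order, and the Riemann-Liouville integral with
  \<open>c = Gamma \<sigma>\<close> otherwise. As \<open>F\<close> need not be integrable, the
  formal relation "the transform of \<open>F\<close> is
  \<open>c * (\<i> * \<omega>) powr (- \<sigma>)\<close> times that of \<open>u\<close>" is imposed
  on its differences.\<close>

locale fractional_antiderivative =
  fixes F u :: "real \<Rightarrow> complex" and m :: nat and \<sigma> c :: real
  assumes F: "times_differentiable m F" "m \<ge> 1"
    and G: "integrable lborel (nth_deriv m F)" "integrable lborel (fourier (nth_deriv m F))"
    and u: "integrable lborel u"
    and \<sigma>: "0 \<le> \<sigma>" "\<sigma> < 1" and c: "c > 0"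
    and bdiff_F: "\<And>h. h > 0 \<Longrightarrow> integrable lborel (bdiff h F)"
      "\<And>h \<omega>. h > 0 \<Longrightarrow> \<omega> \<noteq> 0 \<Longrightarrow>
         fourier (bdiff h F) \<omega> = (1 - cis (- (\<omega> * h))) * (c * (\<i> * \<omega>) powr (- \<sigma>)) * fourier u \<omega>"
begin

lemma u_measurable [measurable]: "u \<in> borel_measurable borel"
  using u by auto

lemma fourier_nth_deriv:
  assumes "\<omega> \<noteq> 0"
  shows "fourier (nth_deriv m F) \<omega> = (\<i> * \<omega>) ^ m * (c * (\<i> * \<omega>) powr (- \<sigma>)) * fourier u \<omega>"
proof -
  \<comment> \<open>Any step with nonzero \<open>1 - cis (- (\<omega> * h))\<close> would allow the
    cancellation at the end; this one makes it exactly \<open>2\<close>.\<close>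
  define h where "h = pi / \<bar>\<omega>\<bar>"
  have h: "h > 0" using assms by (simp add: h_def)
  have two: "1 - cis (- (\<omega> * h)) = 2"
    using assms by (cases "\<omega> > 0") (auto simp: h_def complex_eq_iff)
  obtain k where k: "m = Suc k" using F(2) by (cases m) auto
  \<comment> \<open>The innermost difference makes \<open>F\<close> integrable; the other
    \<open>k\<close> fall under the rule for integrable functions.\<close>
  have "(bdiff h ^^ m) F = (bdiff h ^^ k) (bdiff h F)"
    by (simp add: k funpow_swap1)
  hence "fourier ((bdiff h ^^ m) F) \<omega> = 2 ^ k * fourier (bdiff h F) \<omega>"
    using fourier_bdiff_funpow[OF bdiff_F(1)[OF h], of k h \<omega>] two by simp
  also have "\<dots> = 2 ^ m * (c * (\<i> * \<omega>) powr (- \<sigma>)) * fourier u \<omega>"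
    by (simp only: bdiff_F(2)[OF h assms] two k power_Suc mult_ac)
  finally have "2 ^ m * (c * (\<i> * \<omega>) powr (- \<sigma>)) * fourier u \<omega> * (\<i> * \<omega>) ^ m = 2 ^ m * fourier (nth_deriv m F) \<omega>"
    using fourier_bdiff_nth_deriv[OF F(1) G(1) h, of \<omega>] two by simp
  hence "2 ^ m * fourier (nth_deriv m F) \<omega> = 2 ^ m * ((\<i> * \<omega>) ^ m * (c * (\<i> * \<omega>) powr (- \<sigma>)) * fourier u \<omega>)"
    by (simp only: mult_ac)
  thus ?thesis by (subst (asm) mult_cancel_left) auto
qed

text \<open>On \<open>{-1..1}\<close> the transform of \<open>u\<close> is bounded and
  \<open>\<gamma> > -1\<close> makes the power integrable. Outside, the power is at most
  \<open>\<bar>\<omega>\<bar> powr (m - \<sigma>)\<close>, whose product with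
  \<open>norm (fourier u \<omega>)\<close> is the norm of the transform of the \<open>m\<close>-th
  derivative divided by \<open>c\<close>.\<close>

lemma integrable_powr_fourier:
  assumes \<gamma>: "\<gamma> > -1" "\<gamma> \<le> m - \<sigma>"
  shows "integrable lborel (\<lambda>\<omega>. \<bar>\<omega>\<bar> powr \<gamma> * norm (fourier u \<omega>))"
proof (rule Bochner_Integration.integrable_bound)
  define U where "U = (LINT x|lborel. norm (u x))"
  show "integrable lborel (\<lambda>\<omega>. U * (indicator {-1..1} \<omega> * \<bar>\<omega>\<bar> powr \<gamma>) + norm (fourier (nth_deriv m F) \<omega>) / c)"
    using G by (intro Bochner_Integration.integrable_add integrable_mult_right integrable_divide integrable_abs_powr \<gamma>) auto
  show "AE \<omega> in lborel. norm (\<bar>\<omega>\<bar> powr \<gamma> * norm (fourier u \<omega>)) \<le>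
      norm (U * (indicator {-1..1} \<omega> * \<bar>\<omega>\<bar> powr \<gamma>) + norm (fourier (nth_deriv m F) \<omega>) / c)"
    using AE_lborel_singleton[of 0]
  proof eventually_elim
    case (elim \<omega>)
    have "norm (fourier (nth_deriv m F) \<omega>) = \<bar>\<omega>\<bar> powr real m * (c * \<bar>\<omega>\<bar> powr (- \<sigma>)) * norm (fourier u \<omega>)"
      using elim c norm_imaginary_powr[of \<omega> "- \<sigma>"]
      by (simp add: fourier_nth_deriv norm_mult norm_power powr_realpow)
    also have "\<dots> = c * (\<bar>\<omega>\<bar> powr (m - \<sigma>) * norm (fourier u \<omega>))"
      by (simp add: powr_diff powr_minus field_simps)
    finally have G': "norm (fourier (nth_deriv m F) \<omega>) / c = \<bar>\<omega>\<bar> powr (m - \<sigma>) * norm (fourier u \<omega>)"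
      using c by (simp add: field_simps)
    have U: "norm (fourier u \<omega>) \<le> U" "0 \<le> U"
      unfolding U_def by (auto simp: norm_fourier_le)
    have "\<bar>\<omega>\<bar> powr \<gamma> * norm (fourier u \<omega>) \<le> U * (indicator {-1..1} \<omega> * \<bar>\<omega>\<bar> powr \<gamma>) + \<bar>\<omega>\<bar> powr (m - \<sigma>) * norm (fourier u \<omega>)"
    proof (cases "\<omega> \<in> {-1..1}")
      case True
      thus ?thesis using U by (auto simp: mult.commute intro!: add_increasing2 mult_right_mono)
    next
      case False
      hence "\<bar>\<omega>\<bar> powr \<gamma> \<le> \<bar>\<omega>\<bar> powr (m - \<sigma>)"
        using \<gamma> by (intro powr_mono) (auto simp: abs_if not_le split: if_splits)
      thus ?thesis using False by (auto intro!: mult_right_mono)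
    qed
    thus ?case unfolding G' by simp
  qed
qed measurable

text \<open>The modulus of the symbol is
  \<open>c * \<bar>\<omega>\<bar> powr (k - \<sigma>)\<close>; even for \<open>k = 0\<close> the
  exponent exceeds \<open>-1\<close> because \<open>\<sigma> < 1\<close>.\<close>

lemma integrable_symbol_fourier:
  assumes "k \<le> m"
  shows "integrable lborel (\<lambda>\<omega>. (\<i> * \<omega>) ^ k * (c * (\<i> * \<omega>) powr (- \<sigma>)) * fourier u \<omega>)"
proof (rule Bochner_Integration.integrable_bound)
  show "integrable lborel (\<lambda>\<omega>. c * (\<bar>\<omega>\<bar> powr (k - \<sigma>) * norm (fourier u \<omega>)))"
    using \<sigma> assms by (intro integrable_mult_right integrable_powr_fourier) auto
  show "AE \<omega> in lborel. norm ((\<i> * complex_of_real \<omega>) ^ k * (c * (\<i> * \<omega>) powr (- \<sigma>)) * fourier u \<omega>)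
      \<le> norm (c * (\<bar>\<omega>\<bar> powr (k - \<sigma>) * norm (fourier u \<omega>)))"
    using AE_lborel_singleton[of 0]
  proof eventually_elim
    case (elim \<omega>)
    have "norm ((\<i> * complex_of_real \<omega>) ^ k * (c * (\<i> * \<omega>) powr (- \<sigma>)) * fourier u \<omega>)
       = \<bar>\<omega>\<bar> powr real k * (c * \<bar>\<omega>\<bar> powr (- \<sigma>)) * norm (fourier u \<omega>)"
      using elim c norm_imaginary_powr[of \<omega> "- \<sigma>"]
      by (simp add: norm_mult norm_power powr_realpow)
    also have "\<dots> = c * (\<bar>\<omega>\<bar> powr (k - \<sigma>) * norm (fourier u \<omega>))"
      by (simp add: powr_diff powr_minus field_simps)
    finally show ?case using c by simp
  qed
qed measurable

text \<open>For every positive step the differences of \<open>F\<close> and of the inverse transform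
  agree: those of \<open>F\<close> are continuous and integrable with integrable transform, so
  inversion holds pointwise. Hence the two functions differ by a constant, which stays undetermined
  since differences cannot see it.\<close>

lemma F_eq:
  obtains C where "F = (\<lambda>x. fourier_inv (\<lambda>\<omega>. c * (\<i> * \<omega>) powr (- \<sigma>) * fourier u \<omega>) x + C)"
proof -
  define \<psi> where "\<psi> = (\<lambda>\<omega>. c * (\<i> * complex_of_real \<omega>) powr (- \<sigma>) * fourier u \<omega>)"
  have \<psi>: "integrable lborel \<psi>"
    using integrable_symbol_fourier[of 0] by (simp add: \<psi>_def)
  have [measurable]: "\<psi> \<in> borel_measurable borel" using \<psi> by auto
  have [measurable]: "F \<in> borel_measurable borel" and cont: "continuous_on UNIV F"
  proof -
    have "F differentiable (at x)" for x
      using has_vector_derivative_nth_deriv[OF F(1), of 0 x] F(2) by (auto intro: differentiableI_vector)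
    thus "continuous_on UNIV F"
      by (intro continuous_at_imp_continuous_on ballI differentiable_imp_continuous_within)
    thus "F \<in> borel_measurable borel" by (rule borel_measurable_continuous_onI)
  qed
  have bd: "bdiff h F = bdiff h (fourier_inv \<psi>)" if h: "h > 0" for h
  proof -
    have int: "integrable lborel (\<lambda>\<omega>. cis (\<omega> * (-h)) * \<psi> \<omega>)"
      by (intro integrable_cis_mult \<psi>) auto
    have ae: "AE \<omega> in lborel. fourier (bdiff h F) \<omega> = \<psi> \<omega> - cis (\<omega> * (-h)) * \<psi> \<omega>"
      using AE_lborel_singleton[of 0]
      by eventually_elim (simp add: bdiff_F(2)[OF h] \<psi>_def ring_distribs)
    have [measurable]: "bdiff h F \<in> borel_measurable borel"
      unfolding bdiff_def[abs_def] by measurable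
    have "integrable lborel (fourier (bdiff h F))"
      using Bochner_Integration.integrable_diff[OF \<psi> int] ae
      by (subst integrable_cong_AE) auto
    moreover have "continuous_on UNIV (bdiff h F)"
      unfolding bdiff_def[abs_def]
      by (intro continuous_intros cont continuous_on_compose2[OF cont]) auto
    ultimately have "bdiff h F = fourier_inv (fourier (bdiff h F))"
      by (intro fourier_inversion_continuous bdiff_F h)
    also have "\<dots> = fourier_inv (\<lambda>\<omega>. \<psi> \<omega> - cis (\<omega> * (-h)) * \<psi> \<omega>)"
      by (intro fourier_inv_cong_AE ae) auto
    also have "\<dots> = bdiff h (fourier_inv \<psi>)"
    proof
      fix x
      show "fourier_inv (\<lambda>\<omega>. \<psi> \<omega> - cis (\<omega> * (-h)) * \<psi> \<omega>) x = bdiff h (fourier_inv \<psi>) x"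
        using fourier_inv_diff[OF \<psi> int, of x] fourier_inv_cis[of "-h" \<psi> x]
        by (simp only: bdiff_def add_uminus_conv_diff)
    qed
    finally show ?thesis .
  qed
  have less_eq: "F x - fourier_inv \<psi> x = F y - fourier_inv \<psi> y" if "x < y" for x y
  proof -
    have "bdiff (y - x) F y = bdiff (y - x) (fourier_inv \<psi>) y"
      using bd[of "y - x"] that by simp
    thus ?thesis by (simp add: bdiff_def algebra_simps)
  qed
  have "F x - fourier_inv \<psi> x = F 0 - fourier_inv \<psi> 0" for x
  proof (cases x "0::real" rule: linorder_cases)
    case less
    thus ?thesis by (rule less_eq)
  next
    case greater
    thus ?thesis by (rule less_eq[symmetric])
  qed simp
  hence "F = (\<lambda>x. fourier_inv \<psi> x + (F 0 - fourier_inv \<psi> 0))"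
    by (auto simp: algebra_simps fun_eq_iff)
  thus ?thesis using that unfolding \<psi>_def by blast
qed

text \<open>The first derivative removes the undetermined constant, hence the induction starts at
  \<open>1\<close>; each derivative brings down a factor \<open>\<i> * \<omega>\<close> under the
  inverse transform.\<close>

lemma nth_deriv_F:
  assumes "1 \<le> k" "k \<le> m"
  shows "nth_deriv k F = fourier_inv (\<lambda>\<omega>. (\<i> * \<omega>) ^ k * (c * (\<i> * \<omega>) powr (- \<sigma>)) * fourier u \<omega>)"
proof -
  define \<psi> where "\<psi> = (\<lambda>k \<omega>. (\<i> * complex_of_real \<omega>) ^ k * (c * (\<i> * \<omega>) powr (- \<sigma>)) * fourier u \<omega>)"
  have \<psi>: "integrable lborel (\<psi> k)" if "k \<le> m" for k
    using integrable_symbol_fourier[OF that] by (simp add: \<psi>_def)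
  have deriv: "(fourier_inv (\<psi> k) has_vector_derivative fourier_inv (\<psi> (Suc k)) x) (at x)" if "Suc k \<le> m" for k x
  proof -
    have eq: "\<psi> (Suc k) = (\<lambda>\<omega>. \<i> * \<omega> * \<psi> k \<omega>)"
      by (auto simp: \<psi>_def)
    show ?thesis
      using \<psi>[OF that] \<psi>[of k] that unfolding eq
      by (intro has_vector_derivative_fourier_inv) auto
  qed
  obtain C where C: "F = (\<lambda>x. fourier_inv (\<psi> 0) x + C)"
    using F_eq unfolding \<psi>_def by auto
  have "nth_deriv k F = fourier_inv (\<psi> k)"
    using assms
  proof (induction k rule: nat_induct_at_least)
    case base
    have "(F has_vector_derivative fourier_inv (\<psi> 1) x) (at x)" for x
      unfolding C using deriv[of 0 x] base by (auto intro!: derivative_eq_intros)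
    thus ?case
      by (auto simp: nth_deriv_Suc vector_derivative_at fun_eq_iff)
  next
    case (Suc k)
    have "nth_deriv (Suc k) F x = fourier_inv (\<psi> (Suc k)) x" for x
      unfolding nth_deriv_Suc using Suc deriv[of k x] by (simp add: vector_derivative_at)
    thus ?case by auto
  qed
  thus ?thesis by (simp only: \<psi>_def)
qed

end

section \<open>The Riemann--Liouville kernel\<close>

text \<open>The normalising factor \<open>1 / Gamma s\<close> is left out, so the transforms below
  carry \<open>Gamma s\<close>, the constant \<open>c\<close> of the locale.\<close>

definition power_kernel :: "real \<Rightarrow> real \<Rightarrow> real" where
  "power_kernel s t = (if t > 0 then t powr (s - 1) else 0)"

lemma power_kernel_nonneg [simp]: "power_kernel s t \<ge> 0"
  by (simp add: power_kernel_def)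

lemma borel_measurable_power_kernel [measurable]: "power_kernel s \<in> borel_measurable borel"
  unfolding power_kernel_def[abs_def] by measurable

text \<open>The case \<open>a = 1\<close> is the Gamma integral; the rest is the substitution of
  \<open>a * t\<close> and the homogeneity of the kernel.\<close>

lemma laplace_power_kernel_real:
  assumes s: "s > 0" and a: "a > 0"
  shows "has_bochner_integral lborel (\<lambda>t. power_kernel s t * exp (- (a * t))) (Gamma s * a powr (- s))"
proof -
  have "has_bochner_integral lborel (\<lambda>t. indicator {0..} t * t powr (s - 1) / exp t) (Gamma s)"
    using s Gamma_conv_nn_integral_real[OF s] Gamma_real_pos[OF s]
    by (intro has_bochner_integral_nn_integral) auto
  hence "has_bochner_integral lborel (\<lambda>t. power_kernel s t * exp (- t)) (Gamma s)"
    by (rule has_bochner_integral_cong[THEN iffD1, rotated -1])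
       (auto simp: power_kernel_def exp_minus field_simps split: split_indicator)
  from lborel_has_bochner_integral_real_affine_iff[THEN iffD1, OF _ this, of a 0]
  have "has_bochner_integral lborel (\<lambda>t. a powr (1 - s) * (power_kernel s (a * t) * exp (- (a * t)))) 
     (a powr (1 - s) * (Gamma s / a))"
    using a by (intro has_bochner_integral_mult_right) (auto simp: divide_inverse mult_ac)
  also have "a powr (1 - s) * (Gamma s / a) = Gamma s * a powr (- s)"
    using a by (simp add: powr_diff powr_minus field_simps)
  also have "(\<lambda>t. a powr (1 - s) * (power_kernel s (a * t) * exp (- (a * t)))) = 
     (\<lambda>t. power_kernel s t * exp (- (a * t)))"
  proof
    fix t
    have "a powr (1 - s) * power_kernel s (a * t) = power_kernel s t"
      using a by (auto simp: power_kernel_def zero_less_mult_iff powr_mult powr_diff field_simps)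
    thus "a powr (1 - s) * (power_kernel s (a * t) * exp (- (a * t))) = power_kernel s t * exp (- (a * t))"
      by (metis mult.assoc)
  qed
  finally show ?thesis .
qed

lemma power_kernel_power: "t ^ j * power_kernel s t = power_kernel (s + real j) t"
  by (simp add: power_kernel_def powr_add powr_diff powr_realpow)

lemma integrable_laplace_power_kernel:
  assumes "\<sigma> > 0" "Re s > 0"
  shows "integrable lborel (\<lambda>t. of_real (power_kernel \<sigma> t) * exp (- (s * of_real t)))"
proof (rule Bochner_Integration.integrable_bound)
  show "integrable lborel (\<lambda>t. power_kernel \<sigma> t * exp (- (Re s * t)))"
    using laplace_power_kernel_real[OF assms] by (simp add: has_bochner_integral_iff)
qed (auto simp: norm_mult)

text \<open>This identifies the termwise integrals of the expanded Laplace transform as coefficients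
  of a binomial series with exponent \<open>- \<sigma>\<close>.\<close>

lemma Gamma_pochhammer_gbinomial:
  fixes \<sigma> :: real
  assumes "\<sigma> > 0"
  shows "Gamma (\<sigma> + real j) / fact j = Gamma \<sigma> * ((-1) ^ j * (- \<sigma> gchoose j))"
proof -
  have "\<sigma> \<notin> \<int>\<^sub>\<le>\<^sub>0" using assms by (auto simp: nonpos_Ints_def)
  from pochhammer_Gamma[OF this, of j] have "Gamma (\<sigma> + real j) = Gamma \<sigma> * pochhammer \<sigma> j"
    using Gamma_real_pos[OF assms] by simp
  thus ?thesis
    by (simp add: gbinomial_pochhammer power_mult_distrib[symmetric] flip: mult.assoc)
qed

text \<open>
  The factor \<open>exp (- s t)\<close> is expanded around a large real \<open>a\<close>, for which \<open>\<bar>a - s\<bar> < a\<close>; the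
  termwise integrals form the binomial series of \<open>s powr (- \<sigma>)\<close>.
\<close>

lemma laplace_power_kernel:
  assumes \<sigma>: "\<sigma> > 0" and s: "Re s > 0"
  shows "(LINT t|lborel. of_real (power_kernel \<sigma> t) * exp (- (s * of_real t))) = complex_of_real (Gamma \<sigma>) * s powr of_real (- \<sigma>)"
proof -
  \<comment> \<open>The inequality \<open>norm (a - s) < a\<close> holds exactly for
    \<open>a > (norm s)\<^sup>2 / (2 * Re s)\<close>; this is twice that threshold.\<close>
  define a where "a = (norm s)\<^sup>2 / Re s"
  define z where "z = of_real a - s"
  have "s \<noteq> 0" using s by auto
  have a: "a > 0" using s \<open>s \<noteq> 0\<close> by (simp add: a_def)
  have "(norm z)\<^sup>2 = a\<^sup>2 - 2 * a * Re s + (norm s)\<^sup>2"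
    unfolding cmod_power2 z_def by (simp add: power2_eq_square algebra_simps)
  also have "\<dots> = a\<^sup>2 - (norm s)\<^sup>2"
    using s by (simp add: a_def)
  also have "\<dots> < a\<^sup>2" using \<open>s \<noteq> 0\<close> by simp
  finally have z: "norm z < a" using a by (simp add: power2_less_imp_less)
  define f where "f = (\<lambda>j t. of_real (power_kernel \<sigma> t * exp (- (a * t))) * ((z * of_real t) ^ j / fact j))"
  have f_eq: "f j = (\<lambda>t. z ^ j / fact j * of_real (power_kernel (\<sigma> + real j) t * exp (- (a * t))))" for j
    by (simp add: f_def fun_eq_iff power_kernel_power[symmetric] power_mult_distrib mult_ac)
  have L: "has_bochner_integral lborel (\<lambda>t. power_kernel (\<sigma> + real j) t * exp (- (a * t)))
       (Gamma (\<sigma> + real j) * a powr (- (\<sigma> + real j)))" for j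
    using \<sigma> a by (intro laplace_power_kernel_real) auto
  have f: "has_bochner_integral lborel (f j) (z ^ j / fact j * of_real (Gamma (\<sigma> + real j) * a powr (- (\<sigma> + real j))))" for j
    unfolding f_eq by (intro has_bochner_integral_mult_right has_bochner_integral_of_real L)
  have coeff: "Gamma (\<sigma> + real j) * a powr (- (\<sigma> + real j)) / fact j =
      Gamma \<sigma> * a powr (- \<sigma>) * ((- \<sigma> gchoose j) * (- 1 / a) ^ j)" for j
  proof -
    have "a powr (- (\<sigma> + real j)) = a powr (- \<sigma> - real j)" by simp
    also have "\<dots> = a powr (- \<sigma>) / a ^ j"
      unfolding powr_diff using a by (simp add: powr_realpow)
    finally have "Gamma (\<sigma> + real j) * a powr (- (\<sigma> + real j)) / fact j =
        (Gamma (\<sigma> + real j) / fact j) * (a powr (- \<sigma>) / a ^ j)"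
      by simp
    also have "\<dots> = Gamma \<sigma> * a powr (- \<sigma>) * ((- \<sigma> gchoose j) * ((- 1) ^ j / a ^ j))"
      unfolding Gamma_pochhammer_gbinomial[OF \<sigma>, of j] by simp
    also have "(- 1) ^ j / a ^ j = (- 1 / a) ^ j"
      by (rule power_divide[symmetric])
    finally show ?thesis .
  qed
  \<comment> \<open>Taking norms replaces \<open>z\<close> by \<open>norm z\<close>. The result is
    again a binomial series, convergent because \<open>norm z < a\<close>, and this justifies
    termwise integration.\<close>
  have fn: "(LINT t|lborel. norm (f j t)) = Gamma \<sigma> * a powr (- \<sigma>) * ((- \<sigma> gchoose j) * (- norm z / a) ^ j)" for j
  proof -
    have "(LINT t|lborel. norm (f j t)) = norm z ^ j / fact j * (LINT t|lborel. power_kernel (\<sigma> + real j) t * exp (- (a * t)))"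
      unfolding f_eq by (simp add: norm_mult norm_divide norm_power flip: of_real_mult)
    also have "\<dots> = norm z ^ j * (Gamma (\<sigma> + real j) * a powr (- (\<sigma> + real j)) / fact j)"
      using L[of j] by (simp add: has_bochner_integral_iff)
    also have "\<dots> = Gamma \<sigma> * a powr (- \<sigma>) * ((- \<sigma> gchoose j) * (norm z ^ j * (- 1 / a) ^ j))"
      unfolding coeff by (simp only: mult_ac)
    also have "norm z ^ j * (- 1 / a) ^ j = (- norm z / a) ^ j"
      by (simp flip: power_mult_distrib)
    finally show ?thesis .
  qed
  have sum: "(\<lambda>j. integral\<^sup>L lborel (f j)) sums (LINT t|lborel. (\<Sum>j. f j t))"
  proof (rule sums_integral)
    show "integrable lborel (f j)" for j using f by (simp add: has_bochner_integral_iff)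
    show "summable (\<lambda>j. LINT t|lborel. norm (f j t))"
      unfolding fn
      by (intro summable_mult sums_summable[OF gen_binomial_real]) (use z a in auto)
    show "AE t in lborel. summable (\<lambda>j. norm (f j t))"
    proof (intro AE_I2)
      fix t
      show "summable (\<lambda>j. norm (f j t))"
        unfolding f_def norm_mult
        by (intro summable_mult) (use summable_norm_exp[of "z * of_real t"] in \<open>simp add: scaleR_conv_of_real divide_inverse mult.commute\<close>)
    qed
  qed
  have "(\<Sum>j. f j t) = of_real (power_kernel \<sigma> t) * exp (- (s * of_real t))" for t
  proof -
    have "(\<lambda>j. f j t) sums (of_real (power_kernel \<sigma> t * exp (- (a * t))) * exp (z * of_real t))"
      unfolding f_def using exp_converges[of "z * of_real t"]
      by (intro sums_mult) (simp add: scaleR_conv_of_real divide_inverse mult.commute)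
    also have "of_real (power_kernel \<sigma> t * exp (- (a * t))) * exp (z * of_real t) =
        of_real (power_kernel \<sigma> t) * exp (- (s * of_real t))"
      by (simp add: z_def mult_exp_exp algebra_simps flip: exp_of_real)
    finally show ?thesis by (rule sums_unique[symmetric])
  qed
  moreover have "(\<lambda>j. integral\<^sup>L lborel (f j)) sums (complex_of_real (Gamma \<sigma>) * s powr of_real (- \<sigma>))"
  proof -
    have "norm (- z / of_real a) < 1" using z a by (simp add: norm_divide)
    from gen_binomial_complex[OF this, of "- of_real \<sigma>"]
    have "(\<lambda>j. of_real (Gamma \<sigma> * a powr (- \<sigma>)) * ((- of_real \<sigma> gchoose j) * (- z / of_real a) ^ j)) sums
       (of_real (Gamma \<sigma> * a powr (- \<sigma>)) * (1 + (- z / of_real a)) powr (- of_real \<sigma>))"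
      by (rule sums_mult)
    also have "(\<lambda>j. of_real (Gamma \<sigma> * a powr (- \<sigma>)) * ((- of_real \<sigma> gchoose j) * (- z / of_real a) ^ j)) =
       (\<lambda>j. integral\<^sup>L lborel (f j))"
    proof
      fix j
      have "integral\<^sup>L lborel (f j) = z ^ j * of_real (Gamma (\<sigma> + real j) * a powr (- (\<sigma> + real j)) / fact j)"
        using f[of j] by (simp add: has_bochner_integral_iff)
      also have "\<dots> = of_real (Gamma \<sigma> * a powr (- \<sigma>)) * (of_real (- \<sigma> gchoose j) * (z ^ j * of_real (- 1 / a) ^ j))"
        unfolding coeff by (simp only: of_real_mult of_real_power mult_ac)
      also have "z ^ j * of_real (- 1 / a) ^ j = (- z / of_real a) ^ j"
        by (simp flip: power_mult_distrib)
      finally show "of_real (Gamma \<sigma> * a powr (- \<sigma>)) * ((- of_real \<sigma> gchoose j) * (- z / of_real a) ^ j) = integral\<^sup>L lborel (f j)"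
        by (simp add: gbinomial_prod_rev)
    qed
    also have "1 + (- z / of_real a) = s / of_real a"
      using a by (simp add: z_def field_simps)
    also have "of_real (Gamma \<sigma> * a powr (- \<sigma>)) * (s / of_real a) powr (- of_real \<sigma>) = complex_of_real (Gamma \<sigma>) * s powr of_real (- \<sigma>)"
    proof -
      have "Ln s = Ln (of_real a * (s / of_real a))" using a by simp
      also have "\<dots> = ln a + Ln (s / of_real a)"
        using a \<open>s \<noteq> 0\<close> by (subst Ln_times_of_real) (auto simp: Ln_of_real)
      finally have "s powr (- of_real \<sigma>) = of_real (a powr (- \<sigma>)) * (s / of_real a) powr (- of_real \<sigma>)"
        using a \<open>s \<noteq> 0\<close> by (simp add: powr_def ring_distribs exp_diff exp_minus field_simps flip: exp_of_real)
      thus ?thesis by simp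
    qed
    finally show ?thesis .
  qed
  ultimately show ?thesis
    using sum by (simp add: sums_unique2)
qed

section \<open>Backward differences of the kernel\<close>

definition kernel_diff :: "real \<Rightarrow> real \<Rightarrow> real \<Rightarrow> real" where
  "kernel_diff \<sigma> h t = power_kernel \<sigma> t - power_kernel \<sigma> (t - h)"

lemma borel_measurable_kernel_diff [measurable]: "kernel_diff \<sigma> h \<in> borel_measurable borel"
  unfolding kernel_diff_def[abs_def] by measurable

text \<open>On \<open>{..b}\<close> the factor \<open>exp (b - t)\<close> is at least
  \<open>1\<close>, so \<open>exp b\<close> times the Laplace integrand at \<open>1\<close> is a
  majorant.\<close>

lemma integrable_power_kernel_atMost:
  assumes "\<sigma> > 0"
  shows "integrable lborel (\<lambda>t. indicator {..b} t * power_kernel \<sigma> t)"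
proof (rule Bochner_Integration.integrable_bound)
  show "integrable lborel (\<lambda>t. exp b * (power_kernel \<sigma> t * exp (- (1 * t))))"
    using laplace_power_kernel_real[OF assms zero_less_one] by (simp add: has_bochner_integral_iff)
  show "AE t in lborel. norm (indicator {..b} t * power_kernel \<sigma> t) \<le> norm (exp b * (power_kernel \<sigma> t * exp (- (1 * t))))"
  proof (intro AE_I2)
    fix t
    show "norm (indicator {..b} t * power_kernel \<sigma> t) \<le> norm (exp b * (power_kernel \<sigma> t * exp (- (1 * t))))"
    proof (cases "t \<le> b")
      case True
      hence "1 * power_kernel \<sigma> t \<le> exp (b - t) * power_kernel \<sigma> t"
        by (intro mult_right_mono) auto
      thus ?thesis using True by (simp add: exp_diff exp_minus field_simps)
    qed auto
  qed
qed measurable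

text \<open>Up to \<open>2 * h\<close> both kernels are integrable, singularities included. Beyond
  it their difference has constant sign and an explicit antiderivative, which vanishes at infinity
  because \<open>\<sigma> < 1\<close>; starting at \<open>2 * h\<close> keeps clear of the
  singularity at \<open>h\<close>.\<close>

lemma integrable_kernel_diff:
  assumes \<sigma>: "0 < \<sigma>" "\<sigma> < 1" and h: "h > 0"
  shows "integrable lborel (kernel_diff \<sigma> h)"
proof -
  define A where "A = (\<lambda>t. ((t - h) powr \<sigma> - t powr \<sigma>) / \<sigma>)"
  have "(\<integral>\<^sup>+t. ennreal (- kernel_diff \<sigma> h t) * indicator {2 * h..} t \<partial>lborel) = ennreal (0 - A (2 * h))"
  proof (rule nn_integral_FTC_atLeast)
    show "(A \<longlongrightarrow> 0) at_top"
      unfolding A_def using \<sigma> h by real_asymp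
    fix t assume t: "2 * h \<le> t"
    show "DERIV A t :> - kernel_diff \<sigma> h t"
      unfolding A_def using t h \<sigma>
      by (auto intro!: derivative_eq_intros simp: kernel_diff_def power_kernel_def field_simps)
    show "0 \<le> - kernel_diff \<sigma> h t"
      using t h \<sigma> by (auto simp: kernel_diff_def power_kernel_def intro!: powr_mono2')
  qed measurable
  moreover have "ennreal (- kernel_diff \<sigma> h t) * indicator {2 * h..} t =
      ennreal (norm (indicator {2 * h..} t * kernel_diff \<sigma> h t))" for t
  proof (cases "t \<ge> 2 * h")
    case True
    hence "kernel_diff \<sigma> h t \<le> 0"
      using h \<sigma> by (auto simp: kernel_diff_def power_kernel_def intro!: powr_mono2')
    thus ?thesis by (auto split: split_indicator)
  qed auto
  ultimately have far: "integrable lborel (\<lambda>t. indicator {2 * h..} t * kernel_diff \<sigma> h t)"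
    by (intro integrableI_bounded) auto
  have "integrable lborel (\<lambda>t. indicator {..h} (t - h) * power_kernel \<sigma> (t - h))"
    using lborel_integrable_real_affine[OF integrable_power_kernel_atMost[OF \<sigma>(1), of h], of 1 "-h"]
    by simp
  with integrable_power_kernel_atMost[OF \<sigma>(1), of "2 * h"]
  have "integrable lborel (\<lambda>t. indicator {..2 * h} t * power_kernel \<sigma> t - indicator {..h} (t - h) * power_kernel \<sigma> (t - h)
      + indicator {2 * h..} t * kernel_diff \<sigma> h t)"
    using far by (intro Bochner_Integration.integrable_add Bochner_Integration.integrable_diff)
  moreover have "AE t in lborel. indicator {..2 * h} t * power_kernel \<sigma> t - indicator {..h} (t - h) * power_kernel \<sigma> (t - h)
      + indicator {2 * h..} t * kernel_diff \<sigma> h t = kernel_diff \<sigma> h t"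
    using AE_lborel_singleton[of "2 * h"]
    by eventually_elim (auto simp: kernel_diff_def split: split_indicator)
  ultimately show ?thesis
    by (subst (asm) integrable_cong_AE) auto
qed

text \<open>For \<open>Re s > 0\<close> both shifted kernels have Laplace transforms, and their
  difference carries the factor \<open>1 - exp (- (s * h))\<close>. Letting \<open>s n\<close> tend
  to \<open>\<i> * \<omega>\<close> from the right gives the Fourier transform:
  \<open>norm (kernel_diff \<sigma> h t)\<close> is an integrable majorant, and the power is
  continuous at \<open>\<i> * \<omega>\<close> since \<open>\<omega>\<close> is nonzero.\<close>

lemma fourier_kernel_diff:
  assumes \<sigma>: "0 < \<sigma>" "\<sigma> < 1" and h: "h > 0" and \<omega>: "\<omega> \<noteq> 0"
  shows "fourier (\<lambda>t. kernel_diff \<sigma> h t) \<omega> = (1 - cis (- (\<omega> * h))) * (complex_of_real (Gamma \<sigma>) * (\<i> * \<omega>) powr of_real (- \<sigma>))"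
proof -
  define s where "s = (\<lambda>n. of_real (inverse (real (Suc n))) + \<i> * complex_of_real \<omega>)"
  have s_lim: "s \<longlonglongrightarrow> \<i> * \<omega>"
  proof -
    have "s \<longlonglongrightarrow> of_real 0 + \<i> * complex_of_real \<omega>"
      unfolding s_def by (intro tendsto_intros LIMSEQ_inverse_real_of_nat)
    thus ?thesis by simp
  qed
  have eq: "(LINT t|lborel. exp (- (s n * of_real t)) * of_real (kernel_diff \<sigma> h t)) =
      (1 - exp (- (s n * h))) * (complex_of_real (Gamma \<sigma>) * s n powr of_real (- \<sigma>))" for n
  proof -
    have Re: "Re (s n) > 0" by (simp add: s_def)
    let ?L = "\<lambda>t. of_real (power_kernel \<sigma> t) * exp (- (s n * of_real t))"
    have L: "integrable lborel ?L" by (intro integrable_laplace_power_kernel \<sigma> Re)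
    have L': "integrable lborel (\<lambda>t. exp (- (s n * h)) * ?L (t - h))"
      by (intro integrable_mult_right integrable_shift[OF L])
    have "(LINT t|lborel. exp (- (s n * of_real t)) * of_real (kernel_diff \<sigma> h t)) =
        (LINT t|lborel. ?L t - exp (- (s n * h)) * ?L (t - h))"
      by (intro Bochner_Integration.integral_cong refl)
         (simp add: kernel_diff_def algebra_simps exp_diff exp_minus exp_add divide_inverse)
    also have "\<dots> = integral\<^sup>L lborel ?L - exp (- (s n * h)) * (LINT t|lborel. ?L (t - h))"
      by (subst Bochner_Integration.integral_diff[OF L L']) (simp only: integral_mult_right_zero)
    also have "(LINT t|lborel. ?L (t - h)) = integral\<^sup>L lborel ?L"
      using lborel_integral_real_affine[of 1 ?L "-h"] by simp
    finally show ?thesis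
      unfolding laplace_power_kernel[OF \<sigma>(1) Re] by (simp add: ring_distribs)
  qed
  have "(\<lambda>n. LINT t|lborel. exp (- (s n * of_real t)) * of_real (kernel_diff \<sigma> h t)) \<longlonglongrightarrow>
      (LINT t|lborel. cis (- (\<omega> * t)) * of_real (kernel_diff \<sigma> h t))"
  proof (rule integral_dominated_convergence)
    show "integrable lborel (\<lambda>t. norm (kernel_diff \<sigma> h t))"
      by (intro integrable_norm integrable_kernel_diff \<sigma> h)
    show "AE t in lborel. norm (exp (- (s n * of_real t)) * complex_of_real (kernel_diff \<sigma> h t)) \<le> norm (kernel_diff \<sigma> h t)" for n
    proof (intro AE_I2)
      fix t
      show "norm (exp (- (s n * of_real t)) * complex_of_real (kernel_diff \<sigma> h t)) \<le> norm (kernel_diff \<sigma> h t)"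
      \<comment> \<open>The exponential is at most \<open>1\<close> only for nonnegative
        \<open>t\<close>; for negative \<open>t\<close> both kernels vanish because
        \<open>h > 0\<close>.\<close>
      proof (cases "t \<ge> 0")
        case True
        obtain e where e: "s n = of_real e + \<i> * complex_of_real \<omega>" "e \<ge> 0"
          by (auto simp only: s_def intro!: that) simp
        hence "norm (exp (- (s n * of_real t))) = exp (- (e * t))" by simp
        also have "\<dots> \<le> 1" using True e by simp
        finally show ?thesis
          unfolding norm_mult norm_of_real real_norm_def by (rule mult_left_le_one_le[rotated 2]) auto
      next
        case False
        thus ?thesis using h by (simp add: kernel_diff_def power_kernel_def)
      qed
    qed
    show "AE t in lborel. (\<lambda>n. exp (- (s n * of_real t)) * complex_of_real (kernel_diff \<sigma> h t))
        \<longlonglongrightarrow> cis (- (\<omega> * t)) * of_real (kernel_diff \<sigma> h t)"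
    proof (intro AE_I2)
      fix t
      have "(\<lambda>n. exp (- (s n * of_real t)) * complex_of_real (kernel_diff \<sigma> h t))
        \<longlonglongrightarrow> exp (- ((\<i> * \<omega>) * of_real t)) * of_real (kernel_diff \<sigma> h t)"
        by (intro tendsto_intros s_lim)
      thus "(\<lambda>n. exp (- (s n * of_real t)) * complex_of_real (kernel_diff \<sigma> h t))
        \<longlonglongrightarrow> cis (- (\<omega> * t)) * of_real (kernel_diff \<sigma> h t)"
        by (simp add: cis_conv_exp mult.assoc)
    qed
  qed (unfold s_def, measurable)
  moreover have "(\<lambda>n. (1 - exp (- (s n * h))) * (complex_of_real (Gamma \<sigma>) * s n powr of_real (- \<sigma>)))
      \<longlonglongrightarrow> (1 - exp (- (\<i> * \<omega> * h))) * (complex_of_real (Gamma \<sigma>) * (\<i> * \<omega>) powr of_real (- \<sigma>))"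
    using \<omega> by (intro tendsto_intros s_lim) (auto simp: complex_nonpos_Reals_iff)
  ultimately have "fourier (\<lambda>t. kernel_diff \<sigma> h t) \<omega> = (1 - exp (- (\<i> * \<omega> * h))) * (complex_of_real (Gamma \<sigma>) * (\<i> * \<omega>) powr of_real (- \<sigma>))"
    unfolding eq fourier_cis by (rule LIMSEQ_unique)
  also have "exp (- (\<i> * \<omega> * h)) = cis (- (\<omega> * h))"
    by (simp add: cis_conv_exp mult.assoc)
  finally show ?thesis .
qed

section \<open>The multiplier of the shifted difference operator\<close>

lemma norm_powr_of_real: "norm (z powr complex_of_real a) = norm z powr a"
  by (cases "z = 0") (simp_all add: powr_def)

text \<open>By the asymptotics of binomial coefficients the \<open>k\<close>-th one is at most a
  constant times \<open>k powr (- (\<alpha> + 1))\<close>, which is summable for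
  \<open>\<alpha> > 0\<close>.\<close>

lemma abs_summable_grunwald_coeff:
  assumes "\<alpha> > 0"
  shows "summable (\<lambda>k. \<bar>grunwald_coeff \<alpha> k\<bar>)"
proof -
  have "Bseq (\<lambda>n. (\<alpha> gchoose n) / ((-1) ^ n / exp ((\<alpha> + 1) * of_real (ln (real n)))))"
    using gbinomial_asymptotic[of \<alpha>] by (rule convergentI[THEN convergent_imp_Bseq])
  then obtain B where B: "\<And>n. norm ((\<alpha> gchoose n) / ((-1) ^ n / exp ((\<alpha> + 1) * of_real (ln (real n))))) \<le> B"
    by (auto simp: Bseq_def)
  have "summable (\<lambda>n. B * real n powr (- (\<alpha> + 1)))"
    using assms by (intro summable_mult) (simp add: summable_real_powr_iff)
  thus ?thesis
  proof (rule summable_comparison_test'[where N = 1])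
    fix n :: nat assume n: "n \<ge> 1"
    have "\<bar>\<alpha> gchoose n\<bar> * real n powr (\<alpha> + 1) \<le> B"
      using B[of n] n by (simp add: abs_mult powr_def power_abs)
    hence "\<bar>\<alpha> gchoose n\<bar> \<le> B * real n powr (- (\<alpha> + 1))"
      using n by (simp add: powr_minus field_simps del: minus_add_distrib)
    thus "norm \<bar>grunwald_coeff \<alpha> n\<bar> \<le> B * real n powr (- (\<alpha> + 1))"
      by (simp add: grunwald_coeff_def abs_mult power_abs)
  qed
qed

text \<open>The binomial series covers the open disc only, so \<open>z\<close> on the circle is
  approached radially by \<open>r n * z\<close>; absolute summability of the coefficients lets
  Tannery's theorem exchange limit and sum.\<close>

lemma grunwald_coeff_sums:
  fixes z :: complex
  assumes \<alpha>: "\<alpha> > 0" and z: "norm z = 1"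
  shows "(\<lambda>k. of_real (grunwald_coeff \<alpha> k) * z ^ k) sums ((1 - z) powr of_real \<alpha>)"
proof -
  define r where "r = (\<lambda>n. real n / real (Suc n))"
  have r: "0 \<le> r n" "r n < 1" for n by (auto simp: r_def)
  have r_lim: "r \<longlonglongrightarrow> 1" unfolding r_def by (rule LIMSEQ_n_over_Suc_n)
  have 1: "(\<Sum>k. of_real (grunwald_coeff \<alpha> k) * (of_real (r n) * z) ^ k) = (1 - of_real (r n) * z) powr of_real \<alpha>" for n
  proof -
    have "norm (- (of_real (r n) * z)) < 1" using r z by (simp add: norm_mult)
    from gen_binomial_complex[OF this, of "of_real \<alpha>"]
    moreover have "(of_real \<alpha> gchoose k) * (- (of_real (r n) * z)) ^ k = of_real (grunwald_coeff \<alpha> k) * (of_real (r n) * z) ^ k" for k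
      unfolding power_minus[of "of_real (r n) * z"] by (simp add: grunwald_coeff_def gbinomial_prod_rev)
    ultimately have "(\<lambda>k. of_real (grunwald_coeff \<alpha> k) * (of_real (r n) * z) ^ k) sums (1 - of_real (r n) * z) powr of_real \<alpha>"
      by simp
    thus ?thesis by (rule sums_unique[symmetric])
  qed
  have "(\<lambda>n. \<Sum>k. of_real (grunwald_coeff \<alpha> k) * (of_real (r n) * z) ^ k) \<longlonglongrightarrow> (\<Sum>k. of_real (grunwald_coeff \<alpha> k) * z ^ k)"
  proof (rule tannerys_theorem[where M = "\<lambda>k. \<bar>grunwald_coeff \<alpha> k\<bar>", THEN conjunct2, THEN conjunct2])
    show "(\<lambda>n. of_real (grunwald_coeff \<alpha> k) * (of_real (r n) * z) ^ k) \<longlonglongrightarrow> of_real (grunwald_coeff \<alpha> k) * z ^ k" for k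
    proof -
      have "(\<lambda>n. of_real (grunwald_coeff \<alpha> k) * (of_real (r n) * z) ^ k) \<longlonglongrightarrow> of_real (grunwald_coeff \<alpha> k) * (of_real 1 * z) ^ k"
        by (intro tendsto_intros r_lim)
      thus ?thesis by simp
    qed
    show "\<forall>\<^sub>F (k, n) in sequentially \<times>\<^sub>F sequentially. norm (of_real (grunwald_coeff \<alpha> k) * (of_real (r n) * z) ^ k) \<le> \<bar>grunwald_coeff \<alpha> k\<bar>"
    proof (intro always_eventually, clarify)
      fix k n :: nat
      have "\<bar>r n\<bar> ^ k \<le> 1" using r[of n] by (intro power_le_one) auto
      thus "norm (of_real (grunwald_coeff \<alpha> k) * (of_real (r n) * z) ^ k) \<le> \<bar>grunwald_coeff \<alpha> k\<bar>"
        by (simp add: norm_mult norm_power z mult_left_le)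
    qed
    show "summable (\<lambda>k. \<bar>grunwald_coeff \<alpha> k\<bar>)" by (rule abs_summable_grunwald_coeff[OF \<alpha>])
  qed auto
  moreover have "(\<lambda>n. (1 - of_real (r n) * z) powr of_real \<alpha>) \<longlonglongrightarrow> (1 - z) powr of_real \<alpha>"
  proof -
    have lim: "(\<lambda>n. 1 - of_real (r n) * z) \<longlonglongrightarrow> 1 - z"
      by (rule tendsto_eq_intros r_lim refl | simp)+
    \<comment> \<open>At \<open>z = 1\<close> the base tends to \<open>0\<close>, which lies on the
      branch cut, and \<open>\<alpha> > 0\<close> makes the power tend to \<open>0\<close>;
      elsewhere on the circle \<open>1 - z\<close> is off the cut.\<close>
    show ?thesis
    proof (cases "z = 1")
      case True
      have "(\<lambda>n. (1 - of_real (r n) * z) powr of_real \<alpha>) \<longlonglongrightarrow> 0"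
        by (rule tendsto_powr_complex_0[OF _ tendsto_const]) (use lim \<alpha> True in auto)
      thus ?thesis using True by simp
    next
      case False
      have "1 - z \<notin> \<real>\<^sub>\<le>\<^sub>0"
      proof
        assume *: "1 - z \<in> \<real>\<^sub>\<le>\<^sub>0"
        hence "Re z \<ge> 1" "Im z = 0" by (auto simp: complex_nonpos_Reals_iff)
        moreover have "Re z \<le> 1" using complex_Re_le_cmod[of z] z by simp
        ultimately show False using False by (simp add: complex_eq_iff)
      qed
      thus ?thesis by (intro tendsto_powr_complex lim tendsto_const)
    qed
  qed
  ultimately have "(\<Sum>k. of_real (grunwald_coeff \<alpha> k) * z ^ k) = (1 - z) powr of_real \<alpha>"
    unfolding 1 by (rule LIMSEQ_unique)
  moreover have "summable (\<lambda>k. of_real (grunwald_coeff \<alpha> k) * z ^ k)"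
    by (rule summable_norm_cancel)
       (use abs_summable_grunwald_coeff[OF \<alpha>] in \<open>simp add: norm_mult norm_power z\<close>)
  ultimately show ?thesis by (simp add: sums_iff)
qed

definition grunwald_symbol :: "real \<Rightarrow> int \<Rightarrow> real \<Rightarrow> real \<Rightarrow> complex" where
  "grunwald_symbol \<alpha> r h \<omega> =
     of_real (1 / h powr \<alpha>) * cis (\<omega> * (of_int r * h)) * (1 - cis (- (\<omega> * h))) powr of_real \<alpha>"

text \<open>Since \<open>cis\<close> has norm \<open>1\<close>, absolute summability of the
  coefficients allows summation under the integral. The symbol is bounded for fixed \<open>h\<close>
  because \<open>norm (1 - cis (- (\<omega> * h)))\<close> is at most \<open>2\<close>.\<close>

lemma grunwald_fourier_inv:
  assumes \<alpha>: "\<alpha> > 0" and \<psi>: "integrable lborel \<psi>" and h: "h > 0"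
  shows summable_grunwald_term: "summable (grunwald_term \<alpha> r h (fourier_inv \<psi>) x)"
    and integrable_grunwald_symbol: "integrable lborel (\<lambda>\<omega>. grunwald_symbol \<alpha> r h \<omega> * \<psi> \<omega>)"
    and grunwald_fourier_inv_eq: "grunwald \<alpha> r h (fourier_inv \<psi>) x = fourier_inv (\<lambda>\<omega>. grunwald_symbol \<alpha> r h \<omega> * \<psi> \<omega>) x"
proof -
  define N where "N = (LINT \<omega>|lborel. norm (\<psi> \<omega>))"
  have [measurable]: "\<psi> \<in> borel_measurable borel" using \<psi> by auto
  show "summable (grunwald_term \<alpha> r h (fourier_inv \<psi>) x)"
  proof (rule summable_comparison_test'[where N = 0])
    show "summable (\<lambda>k. \<bar>grunwald_coeff \<alpha> k\<bar> * (1 / (2 * pi) * N))"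
      by (intro summable_mult2 abs_summable_grunwald_coeff \<alpha>)
    show "norm (grunwald_term \<alpha> r h (fourier_inv \<psi>) x k) \<le> \<bar>grunwald_coeff \<alpha> k\<bar> * (1 / (2 * pi) * N)" for k
      unfolding grunwald_term_def norm_mult norm_of_real N_def
      by (intro mult_left_mono norm_fourier_inv_le) auto
  qed
  define f where "f = (\<lambda>k \<omega>. of_real (grunwald_coeff \<alpha> k) * (cis (\<omega> * (x - (real k - of_int r) * h)) * \<psi> \<omega>))"
  have f: "integrable lborel (f k)" for k
    unfolding f_def by (intro integrable_mult_right integrable_cis_mult \<psi>) auto
  have norm_f: "norm (f k \<omega>) = \<bar>grunwald_coeff \<alpha> k\<bar> * norm (\<psi> \<omega>)" for k \<omega>
    by (simp add: f_def norm_mult)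
  have f_sums: "(\<lambda>k. f k \<omega>) sums (cis (\<omega> * x) * (cis (\<omega> * (of_int r * h)) * (1 - cis (- (\<omega> * h))) powr of_real \<alpha> * \<psi> \<omega>))" for \<omega>
  proof -
    have "(\<lambda>k. of_real (grunwald_coeff \<alpha> k) * cis (- (\<omega> * h)) ^ k * (cis (\<omega> * x) * cis (\<omega> * (of_int r * h)) * \<psi> \<omega>)) sums
       ((1 - cis (- (\<omega> * h))) powr of_real \<alpha> * (cis (\<omega> * x) * cis (\<omega> * (of_int r * h)) * \<psi> \<omega>))"
      by (intro sums_mult2 grunwald_coeff_sums \<alpha>) auto
    also have "(\<lambda>k. of_real (grunwald_coeff \<alpha> k) * cis (- (\<omega> * h)) ^ k * (cis (\<omega> * x) * cis (\<omega> * (of_int r * h)) * \<psi> \<omega>)) = (\<lambda>k. f k \<omega>)"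
    proof
      fix k
      have "cis (- (\<omega> * h)) ^ k * cis (\<omega> * x) * cis (\<omega> * (of_int r * h)) = cis (\<omega> * (x - (real k - of_int r) * h))"
        by (simp add: Complex.DeMoivre cis_mult algebra_simps)
      thus "of_real (grunwald_coeff \<alpha> k) * cis (- (\<omega> * h)) ^ k * (cis (\<omega> * x) * cis (\<omega> * (of_int r * h)) * \<psi> \<omega>) = f k \<omega>"
        unfolding f_def by (metis mult.assoc)
    qed
    finally show ?thesis by (simp only: mult_ac)
  qed
  have "(\<lambda>k. integral\<^sup>L lborel (f k)) sums (LINT \<omega>|lborel. (\<Sum>k. f k \<omega>))"
  proof (rule sums_integral)
    show "summable (\<lambda>k. LINT \<omega>|lborel. norm (f k \<omega>))"
      unfolding norm_f using abs_summable_grunwald_coeff[OF \<alpha>] by (simp add: summable_mult2)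
    show "AE \<omega> in lborel. summable (\<lambda>k. norm (f k \<omega>))"
      unfolding norm_f using abs_summable_grunwald_coeff[OF \<alpha>] by (simp add: summable_mult2)
  qed (rule f)
  hence "(\<lambda>k. 1 / (2 * pi) * integral\<^sup>L lborel (f k)) sums (1 / (2 * pi) * (LINT \<omega>|lborel. (\<Sum>k. f k \<omega>)))"
    by (rule sums_mult)
  also have "(\<lambda>k. 1 / (2 * pi) * integral\<^sup>L lborel (f k)) = grunwald_term \<alpha> r h (fourier_inv \<psi>) x"
    by (simp add: fun_eq_iff f_def grunwald_term_def fourier_inv_def)
  finally have "(\<Sum>k. grunwald_term \<alpha> r h (fourier_inv \<psi>) x k) =
      1 / (2 * pi) * (LINT \<omega>|lborel. cis (\<omega> * x) * (cis (\<omega> * (of_int r * h)) * (1 - cis (- (\<omega> * h))) powr of_real \<alpha> * \<psi> \<omega>))"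
    unfolding sums_unique[OF f_sums, symmetric] by (rule sums_unique[symmetric])
  hence "grunwald \<alpha> r h (fourier_inv \<psi>) x = 1 / (2 * pi) * (of_real (1 / h powr \<alpha>) *
      (LINT \<omega>|lborel. cis (\<omega> * x) * (cis (\<omega> * (of_int r * h)) * (1 - cis (- (\<omega> * h))) powr of_real \<alpha> * \<psi> \<omega>)))"
    unfolding grunwald_def by simp
  also have "\<dots> = fourier_inv (\<lambda>\<omega>. grunwald_symbol \<alpha> r h \<omega> * \<psi> \<omega>) x"
    unfolding integral_mult_right_zero[symmetric] fourier_inv_def grunwald_symbol_def by (simp only: mult_ac)
  finally show "grunwald \<alpha> r h (fourier_inv \<psi>) x = fourier_inv (\<lambda>\<omega>. grunwald_symbol \<alpha> r h \<omega> * \<psi> \<omega>) x" .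
  \<comment> \<open>Measurability of the power is read off from the series, as a pointwise limit of
    measurable partial sums.\<close>
  have meas: "(\<lambda>\<omega>. (1 - cis (- (\<omega> * h))) powr complex_of_real \<alpha>) \<in> borel_measurable borel"
  proof (rule borel_measurable_LIMSEQ_metric)
    show "(\<lambda>\<omega>. \<Sum>k<n. of_real (grunwald_coeff \<alpha> k) * cis (- (\<omega> * h)) ^ k) \<in> borel_measurable borel" for n
      by measurable
    show "(\<lambda>n. \<Sum>k<n. of_real (grunwald_coeff \<alpha> k) * cis (- (\<omega> * h)) ^ k) \<longlonglongrightarrow> (1 - cis (- (\<omega> * h))) powr complex_of_real \<alpha>" for \<omega>
      using grunwald_coeff_sums[OF \<alpha>, of "cis (- (\<omega> * h))"] by (simp add: sums_def)
  qed
  show "integrable lborel (\<lambda>\<omega>. grunwald_symbol \<alpha> r h \<omega> * \<psi> \<omega>)"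
  proof (rule Bochner_Integration.integrable_bound)
    show "integrable lborel (\<lambda>\<omega>. 1 / h powr \<alpha> * 2 powr \<alpha> * norm (\<psi> \<omega>))"
      using \<psi> by auto
    show "AE \<omega> in lborel. norm (grunwald_symbol \<alpha> r h \<omega> * \<psi> \<omega>) \<le> norm (1 / h powr \<alpha> * 2 powr \<alpha> * norm (\<psi> \<omega>))"
    proof (intro AE_I2)
      fix \<omega>
      have "norm (1 - cis (- (\<omega> * h))) \<le> 2"
        using norm_triangle_ineq4[of 1 "cis (- (\<omega> * h))"] by simp
      hence "norm (1 - cis (- (\<omega> * h))) powr \<alpha> \<le> 2 powr \<alpha>"
        using \<alpha> by (intro powr_mono2) auto
      hence "norm (grunwald_symbol \<alpha> r h \<omega>) \<le> 1 / h powr \<alpha> * 2 powr \<alpha>"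
        by (simp add: grunwald_symbol_def norm_mult norm_divide norm_powr_of_real divide_right_mono)
      from mult_right_mono[OF this norm_ge_zero[of "\<psi> \<omega>"]]
      show "norm (grunwald_symbol \<alpha> r h \<omega> * \<psi> \<omega>) \<le> norm (1 / h powr \<alpha> * 2 powr \<alpha> * norm (\<psi> \<omega>))"
        by (simp add: norm_mult)
    qed
    show "(\<lambda>\<omega>. grunwald_symbol \<alpha> r h \<omega> * \<psi> \<omega>) \<in> borel_measurable lborel"
      unfolding grunwald_symbol_def using meas by measurable
  qed
qed

section \<open>Taylor estimates for the symbols\<close>

lemma one_plus_powr_approx:
  fixes a :: complex
  shows "\<exists>B. \<forall>y. norm y \<le> 1 / 2 \<longrightarrow> norm ((1 + y) powr a - (1 + a * y)) \<le> B * (norm y)\<^sup>2"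
proof -
  define S :: "complex set" where "S = cball 0 (1 / 2)"
  \<comment> \<open>\<open>f 0\<close>, \<open>f 1\<close>, \<open>f 2\<close> are the successive
    derivatives of \<open>(1 + y) powr a\<close>, as \<open>complex_Taylor\<close> expects. On the
    ball of radius \<open>1 / 2\<close> the real part of \<open>1 + y\<close> is positive, so the
    branch cut is avoided and compactness bounds \<open>f 2\<close>.\<close>
  define f where "f = (\<lambda>i::nat. \<lambda>y::complex. if i = 0 then (1 + y) powr a else if i = 1 then a * (1 + y) powr (a - 1)
     else a * (a - 1) * (1 + y) powr (a - 2))"
  have S': "Re (1 + y) > 0" if "y \<in> S" for y
  proof -
    have "\<bar>Re y\<bar> \<le> 1 / 2" using that abs_Re_le_cmod[of y] by (simp add: S_def)
    thus ?thesis by simp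
  qed
  hence S: "1 + y \<notin> \<real>\<^sub>\<le>\<^sub>0" if "y \<in> S" for y
    using that by (force simp: complex_nonpos_Reals_iff)
  have "continuous_on S (\<lambda>y. (1 + y) powr (a - 2))"
    by (intro continuous_on_powr_complex continuous_intros) (use S' in \<open>force simp: complex_eq_iff\<close>)+
  hence "continuous_on S (f 2)"
    unfolding f_def by (auto intro!: continuous_intros)
  hence "bounded (f 2 ` S)"
    by (intro compact_imp_bounded compact_continuous_image) (auto simp: S_def)
  then obtain B where B: "\<And>y. y \<in> S \<Longrightarrow> norm (f 2 y) \<le> B"
    by (auto simp: bounded_iff)
  have "norm ((1 + y) powr a - (1 + a * y)) \<le> B * (norm y)\<^sup>2" if y: "norm y \<le> 1 / 2" for y
  proof -
    have "norm (f 0 y - (\<Sum>i\<le>1. f i 0 * (y - 0) ^ i / fact i)) \<le> B * norm (y - 0) ^ Suc 1 / fact 1"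
    proof (rule complex_Taylor[where S = S])
      fix i x assume x: "x \<in> S" and "i \<le> (1::nat)"
      then consider "i = 0" | "i = 1" by linarith
      thus "(f i has_field_derivative f (Suc i) x) (at x within S)"
      proof cases
        case 1
        thus ?thesis
          unfolding f_def using S[OF x] by (auto intro!: derivative_eq_intros)
      next
        case 2
        thus ?thesis
          unfolding f_def using S[OF x] by (auto intro!: derivative_eq_intros simp: algebra_simps)
      qed
    qed (use B y in \<open>auto simp: S_def numeral_2_eq_2\<close>)
    thus ?thesis by (simp add: f_def numeral_2_eq_2)
  qed
  thus ?thesis by blast
qed

lemma cis_approx1: "norm (cis x - (1 + \<i> * of_real x)) \<le> x\<^sup>2 / 2"
  using iexp_approx1[of x 1] by (simp add: cis_conv_exp numeral_2_eq_2 add.commute)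

text \<open>This is the cubic Taylor remainder of \<open>cis (- z)\<close> divided by
  \<open>\<bar>z\<bar>\<close>.\<close>

lemma cis_difference_quotient_approx:
  assumes "z \<noteq> 0"
  shows "norm ((1 - cis (- z)) / (\<i> * of_real z) - (1 - \<i> * of_real z / 2)) \<le> z\<^sup>2 / 6"
proof -
  have "norm (cis (- z) - (1 + \<i> * of_real (- z) + (\<i> * of_real (- z))\<^sup>2 / 2)) \<le> \<bar>z\<bar> ^ 3 / 6"
    using iexp_approx1[of "-z" 2] by (simp add: cis_conv_exp numeral_2_eq_2 numeral_3_eq_3 fact_reduce algebra_simps)
  also have "cis (- z) - (1 + \<i> * of_real (- z) + (\<i> * of_real (- z))\<^sup>2 / 2) = 
      - ((\<i> * of_real z) * ((1 - cis (- z)) / (\<i> * of_real z) - (1 - \<i> * of_real z / 2)))"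
    using assms by (simp add: field_simps power2_eq_square)
  also have "norm \<dots> = \<bar>z\<bar> * norm ((1 - cis (- z)) / (\<i> * of_real z) - (1 - \<i> * of_real z / 2))"
    unfolding norm_minus_cancel norm_mult by simp
  also have "\<bar>z\<bar> ^ 3 / 6 = \<bar>z\<bar> * (z\<^sup>2 / 6)"
    by (simp add: power2_eq_square power3_eq_cube)
  finally show ?thesis using assms by simp
qed

text \<open>Near \<open>0\<close>, dividing by \<open>(\<i> * z) powr \<alpha>\<close> leaves
  \<open>Q z powr \<alpha> * E z\<close>. The first condition on \<open>a\<close> and
  \<open>b\<close> gives \<open>E z\<close> the constant term \<open>1\<close>, the second the
  linear term \<open>w z\<close>, which cancels the linear term \<open>- w z\<close> of
  \<open>Q z powr \<alpha>\<close>. For \<open>\<bar>z\<bar> > 1 / 2\<close> both symbols are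
  bounded separately by multiples of \<open>\<bar>z\<bar> powr (\<alpha> + 2)\<close>.\<close>

lemma wsgd_symbol_bound:
  fixes \<alpha> a b p q :: real
  assumes \<alpha>: "\<alpha> > 0" and ab: "a + b = 1" "a * p + b * q = \<alpha> / 2"
  shows "\<exists>C\<ge>0. \<forall>z. norm ((1 - cis (- z)) powr of_real \<alpha> * (of_real a * cis (z * p) + of_real b * cis (z * q))
           - (\<i> * of_real z) powr of_real \<alpha>) \<le> C * \<bar>z\<bar> powr (\<alpha> + 2)"
proof -
  define E where "E = (\<lambda>z. of_real a * cis (z * p) + of_real b * cis (z * q))"
  define Q where "Q = (\<lambda>z. (1 - cis (- z)) / (\<i> * of_real z))"
  define w where "w = (\<lambda>z. \<i> * of_real (\<alpha> * z / 2))"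
  have normE: "norm (E z) \<le> \<bar>a\<bar> + \<bar>b\<bar>" for z
    unfolding E_def by (rule order_trans[OF norm_triangle_ineq]) (simp add: norm_mult)
  define B' where "B' = \<bar>a\<bar> * p\<^sup>2 + \<bar>b\<bar> * q\<^sup>2"
  have E: "norm (E z - (1 + w z)) \<le> B' * z\<^sup>2" for z
  proof -
    have "complex_of_real (a + b) = 1" "complex_of_real (a * p + b * q) = of_real (\<alpha> / 2)"
      unfolding ab by simp_all
    hence "1 + w z = (of_real a + of_real b) + \<i> * (of_real a * of_real p + of_real b * of_real q) * of_real z"
      by (simp add: w_def mult_ac)
    hence "E z - (1 + w z) = of_real a * (cis (z * p) - (1 + \<i> * of_real (z * p))) +
             of_real b * (cis (z * q) - (1 + \<i> * of_real (z * q)))"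
      by (simp add: E_def algebra_simps)
    also have "norm \<dots> \<le> \<bar>a\<bar> * ((z * p)\<^sup>2 / 2) + \<bar>b\<bar> * ((z * q)\<^sup>2 / 2)"
      by (rule order_trans[OF norm_triangle_ineq], unfold norm_mult norm_of_real)
         (intro add_mono mult_left_mono cis_approx1; simp)
    also have "\<dots> = B' * z\<^sup>2 / 2" by (simp add: B'_def power_mult_distrib field_simps)
    also have "\<dots> \<le> B' * z\<^sup>2" by (simp add: B'_def)
    finally show ?thesis .
  qed
  have "B' \<ge> 0" by (simp add: B'_def)
  obtain B0 where B0: "\<And>y::complex. norm y \<le> 1 / 2 \<Longrightarrow> norm ((1 + y) powr of_real \<alpha> - (1 + of_real \<alpha> * y)) \<le> B0 * (norm y)\<^sup>2"
    using one_plus_powr_approx by blast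
  define B where "B = max B0 0"
  have B: "norm ((1 + y) powr of_real \<alpha> - (1 + of_real \<alpha> * y)) \<le> B * (norm y)\<^sup>2" if "norm y \<le> 1 / 2" for y :: complex
    by (rule order_trans[OF B0[OF that]]) (auto simp: B_def intro!: mult_right_mono)
  have "B \<ge> 0" by (simp add: B_def)
  \<comment> \<open>\<open>C1\<close> collects the three terms of the expansion of
    \<open>Q z powr \<alpha> * E z - 1\<close> below. \<open>C2\<close> comes from
    \<open>1 \<le> (2 * \<bar>z\<bar>) powr (\<alpha> + 2)\<close> and
    \<open>1 \<le> 4 * z\<^sup>2\<close>, both valid for
    \<open>\<bar>z\<bar> > 1 / 2\<close>.\<close>
  define C1 where "C1 = \<alpha>\<^sup>2 + (1 + \<alpha>) * B' + (B + \<alpha>) * (\<bar>a\<bar> + \<bar>b\<bar>)"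
  define C2 where "C2 = 2 powr (\<alpha> + 2) * (2 powr \<alpha> * (\<bar>a\<bar> + \<bar>b\<bar>)) + 4"
  have C: "0 \<le> C1" "0 \<le> C2" using \<alpha> \<open>B' \<ge> 0\<close> \<open>B \<ge> 0\<close> by (auto simp: C1_def C2_def)
  have near: "norm ((1 - cis (- z)) powr of_real \<alpha> * E z - (\<i> * of_real z) powr of_real \<alpha>) \<le> C1 * \<bar>z\<bar> powr (\<alpha> + 2)"
    if z: "\<bar>z\<bar> \<le> 1 / 2" "z \<noteq> 0" for z
  proof -
    define y where "y = Q z - 1"
    have y1: "norm (y + \<i> * of_real z / 2) \<le> z\<^sup>2 / 6"
      using cis_difference_quotient_approx[OF z(2)] by (simp add: y_def Q_def algebra_simps)
    have z2: "z\<^sup>2 \<le> \<bar>z\<bar> * (1 / 2)"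
      using mult_left_mono[OF z(1), of "\<bar>z\<bar>"] by (simp add: power2_eq_square)
    have "norm y \<le> norm (y + \<i> * of_real z / 2) + norm (\<i> * of_real z / 2)"
      using norm_triangle_ineq4[of "y + \<i> * of_real z / 2" "\<i> * of_real z / 2"] by simp
    also have "\<dots> \<le> z\<^sup>2 / 6 + \<bar>z\<bar> / 2" using y1 by (simp add: norm_mult)
    also have "\<dots> \<le> \<bar>z\<bar>" using z2 by simp
    finally have y2: "norm y \<le> \<bar>z\<bar>" .
    have y3: "norm y \<le> 1 / 2" using y2 z by linarith
    have ReQ: "Re (Q z) > 0"
      using abs_Re_le_cmod[of y] y3 by (simp add: y_def)
    have Qy: "Q z = 1 + y" by (simp add: y_def)
    have nz: "\<i> * complex_of_real z \<noteq> 0" "Q z \<noteq> 0" using z ReQ by auto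
    \<comment> \<open>The argument of \<open>\<i> * z\<close> is at most \<open>pi / 2\<close> in
      absolute value and that of \<open>Q z\<close> is strictly smaller than \<open>pi / 2\<close>,
      so their sum stays off the branch cut and the logarithms add.\<close>
    have split: "(1 - cis (- z)) powr of_real \<alpha> = (\<i> * of_real z) powr of_real \<alpha> * (Q z) powr of_real \<alpha>"
    proof -
      have "\<bar>Im (Ln (\<i> * of_real z))\<bar> \<le> pi / 2" using nz by (subst Re_Ln_pos_le) auto
      moreover have "\<bar>Im (Ln (Q z))\<bar> < pi / 2" using nz ReQ by (subst Re_Ln_pos_lt) auto
      ultimately have "Ln ((\<i> * of_real z) * Q z) = Ln (\<i> * of_real z) + Ln (Q z)"
        using nz by (intro Ln_times_simple) auto
      moreover have "(\<i> * of_real z) * Q z = 1 - cis (- z)" using z by (simp add: Q_def)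
      ultimately show ?thesis
        using nz by (auto simp: powr_def ring_distribs exp_add)
    qed
    define e1 where "e1 = (Q z) powr of_real \<alpha> - (1 - w z)"
    define e2 where "e2 = E z - (1 + w z)"
    have e1: "norm e1 \<le> (B + \<alpha>) * z\<^sup>2"
    proof -
      have "e1 = ((1 + y) powr of_real \<alpha> - (1 + of_real \<alpha> * y)) + of_real \<alpha> * (y + \<i> * of_real z / 2)"
        by (simp add: e1_def Qy w_def algebra_simps)
      also have "norm \<dots> \<le> B * (norm y)\<^sup>2 + \<alpha> * (z\<^sup>2 / 6)"
        by (rule order_trans[OF norm_triangle_ineq], unfold norm_mult norm_of_real)
           (use \<alpha> B[OF y3] y1 in \<open>intro add_mono mult_mono; simp\<close>)
      also have "\<dots> \<le> B * z\<^sup>2 + \<alpha> * z\<^sup>2"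
        using y2 \<open>B \<ge> 0\<close> \<alpha> by (intro add_mono mult_left_mono) (auto simp: abs_le_square_iff[symmetric])
      finally show ?thesis by (simp add: ring_distribs)
    qed
    have e2: "norm e2 \<le> B' * z\<^sup>2" unfolding e2_def by (rule E)
    have w: "norm (w z) \<le> \<alpha> * \<bar>z\<bar>" "norm (w z) \<le> \<alpha>"
    proof -
      have "norm (w z) = \<alpha> * \<bar>z\<bar> / 2" using \<alpha> by (simp add: w_def norm_mult abs_mult)
      moreover have "\<alpha> * \<bar>z\<bar> \<le> \<alpha> * (1 / 2)" using z \<alpha> by (intro mult_left_mono) auto
      moreover have "0 \<le> \<alpha> * \<bar>z\<bar>" using \<alpha> by simp
      ultimately show "norm (w z) \<le> \<alpha> * \<bar>z\<bar>" "norm (w z) \<le> \<alpha>" using \<alpha> by linarith+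
    qed
    \<comment> \<open>The product \<open>(1 - w z) * (1 + w z) = 1 - (w z)\<^sup>2\<close> has no
      linear term.\<close>
    have "(Q z) powr of_real \<alpha> * E z - 1 = - (w z)\<^sup>2 + (1 - w z) * e2 + e1 * E z"
      by (simp add: e1_def e2_def algebra_simps power2_eq_square)
    also have "norm \<dots> \<le> norm (w z) ^ 2 + norm (1 - w z) * norm e2 + norm e1 * norm (E z)"
      by (rule order_trans[OF norm_triangle_ineq], rule add_mono, rule order_trans[OF norm_triangle_ineq])
         (simp_all add: norm_mult norm_power)
    also have "\<dots> \<le> (\<alpha> * \<bar>z\<bar>) ^ 2 + (1 + \<alpha>) * (B' * z\<^sup>2) + ((B + \<alpha>) * z\<^sup>2) * (\<bar>a\<bar> + \<bar>b\<bar>)"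
    proof (intro add_mono mult_mono power_mono e1 e2 normE w)
      show "norm (1 - w z) \<le> 1 + \<alpha>"
        using norm_triangle_ineq4[of 1 "w z"] w(2) by simp
    qed (use \<alpha> \<open>B \<ge> 0\<close> in auto)
    also have "\<dots> = C1 * z\<^sup>2"
      by (simp add: C1_def power_mult_distrib algebra_simps)
    finally have main: "norm ((Q z) powr of_real \<alpha> * E z - 1) \<le> C1 * z\<^sup>2" .
    have "(1 - cis (- z)) powr of_real \<alpha> * E z - (\<i> * of_real z) powr of_real \<alpha> =
        (\<i> * of_real z) powr of_real \<alpha> * ((Q z) powr of_real \<alpha> * E z - 1)"
      unfolding split by (simp add: ring_distribs)
    also have "norm \<dots> \<le> \<bar>z\<bar> powr \<alpha> * (C1 * z\<^sup>2)"
      unfolding norm_mult[of "(\<i> * of_real z) powr of_real \<alpha>"] norm_powr_of_real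
      by (intro mult_mono main) (auto simp: norm_mult)
    also have "\<dots> = C1 * \<bar>z\<bar> powr (\<alpha> + 2)"
      using z by (simp add: powr_add mult_ac)
    finally show ?thesis .
  qed
  have far: "norm ((1 - cis (- z)) powr of_real \<alpha> * E z - (\<i> * of_real z) powr of_real \<alpha>) \<le> C2 * \<bar>z\<bar> powr (\<alpha> + 2)"
    if z: "\<bar>z\<bar> > 1 / 2" for z
  proof -
    have "norm (1 - cis (- z)) \<le> 2"
      using norm_triangle_ineq4[of 1 "cis (- z)"] by simp
    hence "norm ((1 - cis (- z)) powr of_real \<alpha>) \<le> 2 powr \<alpha>"
      unfolding norm_powr_of_real using \<alpha> by (intro powr_mono2) auto
    hence "norm ((1 - cis (- z)) powr of_real \<alpha> * E z) \<le> 2 powr \<alpha> * (\<bar>a\<bar> + \<bar>b\<bar>)"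
      unfolding norm_mult by (intro mult_mono normE) auto
    also have "1 * \<dots> \<le> (2 * \<bar>z\<bar>) powr (\<alpha> + 2) * (2 powr \<alpha> * (\<bar>a\<bar> + \<bar>b\<bar>))"
      using z \<alpha> by (intro mult_right_mono ge_one_powr_ge_zero) auto
    finally have 1: "norm ((1 - cis (- z)) powr of_real \<alpha> * E z) \<le>
        2 powr (\<alpha> + 2) * (2 powr \<alpha> * (\<bar>a\<bar> + \<bar>b\<bar>)) * \<bar>z\<bar> powr (\<alpha> + 2)"
      by (simp add: powr_mult mult_ac)
    have "1 / 4 \<le> z\<^sup>2"
      using power_mono[of "1 / 2" "\<bar>z\<bar>" 2] z by (simp add: power2_eq_square)
    hence "\<bar>z\<bar> powr \<alpha> * 1 \<le> \<bar>z\<bar> powr \<alpha> * (4 * z\<^sup>2)"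
      by (intro mult_left_mono) auto
    also have "\<dots> = 4 * \<bar>z\<bar> powr (\<alpha> + 2)"
      using z by (simp add: powr_add mult_ac)
    finally have 2: "norm ((\<i> * complex_of_real z) powr of_real \<alpha>) \<le> 4 * \<bar>z\<bar> powr (\<alpha> + 2)"
      by (simp add: norm_powr_of_real norm_mult)
    show ?thesis
      using order_trans[OF norm_triangle_ineq4 add_mono[OF 1 2]] by (simp add: C2_def ring_distribs)
  qed
  have "norm ((1 - cis (- z)) powr of_real \<alpha> * E z - (\<i> * of_real z) powr of_real \<alpha>) \<le> (C1 + C2) * \<bar>z\<bar> powr (\<alpha> + 2)" for z
  proof -
    consider "z = 0" | "\<bar>z\<bar> \<le> 1 / 2" "z \<noteq> 0" | "\<bar>z\<bar> > 1 / 2" by linarith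
    thus ?thesis
    proof cases
      case 2
      from near[OF this] C show ?thesis by (simp add: ring_distribs add_increasing2)
    next
      case 3
      from far[OF this] C show ?thesis by (simp add: ring_distribs add_increasing)
    qed auto
  qed
  thus ?thesis
    using C unfolding E_def by (intro exI[of _ "C1 + C2"]) auto
qed

section \<open>The weighted and shifted operator\<close>

lemma integrable_cmult_cancel:
  fixes f :: "'a \<Rightarrow> complex"
  assumes "integrable M (\<lambda>x. c * f x)" "c \<noteq> 0"
  shows "integrable M f"
  using integrable_mult_right[OF assms(1), of "1 / c"] assms(2) by simp

text \<open>The error is the inverse transform of the difference of the symbols times
  \<open>\<psi>\<close>, so its absolute value is at most the L1 norm of that product over
  \<open>2 * pi\<close>, whatever \<open>x\<close> is. This is the source of uniformity.\<close>

lemma wsgd_fourier_inv_error: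
  assumes \<alpha>: "\<alpha> > 0" and pq: "p \<noteq> q" and \<psi>: "integrable lborel \<psi>"
    and \<psi>1: "integrable lborel (\<lambda>\<omega>. (\<i> * of_real \<omega>) powr of_real \<alpha> * \<psi> \<omega>)"
    and \<psi>2: "integrable lborel (\<lambda>\<omega>. \<bar>\<omega>\<bar> powr (\<alpha> + 2) * norm (\<psi> \<omega>))"
  shows "\<exists>C. \<forall>h>0. \<forall>x. norm (wsgd \<alpha> p q h (fourier_inv \<psi>) x -
      fourier_inv (\<lambda>\<omega>. (\<i> * of_real \<omega>) powr of_real \<alpha> * \<psi> \<omega>) x) \<le> C * h\<^sup>2"
proof -
  define a b where "a = (\<alpha> - 2 * of_int q) / (2 * (of_int p - of_int q))"
    and "b = (2 * of_int p - \<alpha>) / (2 * (of_int p - of_int q))"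
  have d: "of_int p - of_int q \<noteq> (0::real)" using pq by simp
  \<comment> \<open>The WSGD weights are the solution of these two linear equations.\<close>
  have ab: "a + b = 1" "a * of_int p + b * of_int q = \<alpha> / 2"
  proof -
    show "a + b = 1"
      unfolding a_def b_def add_divide_distrib[symmetric] using d by simp
    have "a * of_int p + b * of_int q = ((\<alpha> - 2 * of_int q) * of_int p + (2 * of_int p - \<alpha>) * of_int q) / (2 * (of_int p - of_int q))"
      by (simp add: a_def b_def add_divide_distrib)
    also have "(\<alpha> - 2 * of_int q) * of_int p + (2 * of_int p - \<alpha>) * of_int q = \<alpha> * (of_int p - of_int q)"
      by (simp add: algebra_simps)
    finally show "a * of_int p + b * of_int q = \<alpha> / 2"
      using mult_divide_mult_cancel_right[OF d, of \<alpha> 2] by (simp only:)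
  qed
  obtain C where C: "C \<ge> 0" "\<And>z. norm ((1 - cis (- z)) powr of_real \<alpha> * (of_real a * cis (z * of_int p) + of_real b * cis (z * of_int q))
           - (\<i> * of_real z) powr of_real \<alpha>) \<le> C * \<bar>z\<bar> powr (\<alpha> + 2)"
    using wsgd_symbol_bound[OF \<alpha> ab] by blast
  have "norm (wsgd \<alpha> p q h (fourier_inv \<psi>) x - fourier_inv (\<lambda>\<omega>. (\<i> * of_real \<omega>) powr of_real \<alpha> * \<psi> \<omega>) x)
      \<le> 1 / (2 * pi) * (C * (LINT \<omega>|lborel. \<bar>\<omega>\<bar> powr (\<alpha> + 2) * norm (\<psi> \<omega>))) * h\<^sup>2" if h: "h > 0" for h x
  proof -
    let ?G = "grunwald_symbol \<alpha>" and ?D = "\<lambda>\<omega>. (\<i> * of_real \<omega>) powr of_real \<alpha> :: complex"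
    have intG: "integrable lborel (\<lambda>\<omega>. ?G r h \<omega> * \<psi> \<omega>)" for r
      by (rule integrable_grunwald_symbol[OF \<alpha> \<psi> h])
    define \<psi>d where "\<psi>d = (\<lambda>\<omega>. of_real a * (?G p h \<omega> * \<psi> \<omega>) + of_real b * (?G q h \<omega> * \<psi> \<omega>) - ?D \<omega> * \<psi> \<omega>)"
    have int_d: "integrable lborel \<psi>d"
      unfolding \<psi>d_def
      by (intro Bochner_Integration.integrable_diff Bochner_Integration.integrable_add integrable_mult_right intG \<psi>1)
    have "wsgd \<alpha> p q h (fourier_inv \<psi>) x - fourier_inv (\<lambda>\<omega>. ?D \<omega> * \<psi> \<omega>) x = fourier_inv \<psi>d x"
    proof -
      have i: "integrable lborel (\<lambda>\<omega>. cis (\<omega> * x) * (?G r h \<omega> * \<psi> \<omega>))" for r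
        by (intro integrable_cis_mult intG) auto
      have i': "integrable lborel (\<lambda>\<omega>. cis (\<omega> * x) * (?D \<omega> * \<psi> \<omega>))"
        by (intro integrable_cis_mult \<psi>1) auto
      have "(LINT \<omega>|lborel. cis (\<omega> * x) * \<psi>d \<omega>) =
         (LINT \<omega>|lborel. of_real a * (cis (\<omega> * x) * (?G p h \<omega> * \<psi> \<omega>)) + of_real b * (cis (\<omega> * x) * (?G q h \<omega> * \<psi> \<omega>))
            - cis (\<omega> * x) * (?D \<omega> * \<psi> \<omega>))"
        unfolding \<psi>d_def by (simp only: ring_distribs mult.left_commute)
      also have "\<dots> = of_real a * (LINT \<omega>|lborel. cis (\<omega> * x) * (?G p h \<omega> * \<psi> \<omega>)) + of_real b * (LINT \<omega>|lborel. cis (\<omega> * x) * (?G q h \<omega> * \<psi> \<omega>))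
            - (LINT \<omega>|lborel. cis (\<omega> * x) * (?D \<omega> * \<psi> \<omega>))"
        by (simp only: Bochner_Integration.integral_diff Bochner_Integration.integral_add
              Bochner_Integration.integrable_add integrable_mult_right i i' integral_mult_right_zero)
      finally have eq: "(LINT \<omega>|lborel. cis (\<omega> * x) * \<psi>d \<omega>) = \<dots>" .
      show ?thesis
        unfolding wsgd_def grunwald_fourier_inv_eq[OF \<alpha> \<psi> h] a_def[symmetric] b_def[symmetric]
        unfolding fourier_inv_def eq by (simp only: ring_distribs mult_ac)
    qed
    also have "norm \<dots> \<le> 1 / (2 * pi) * (LINT \<omega>|lborel. norm (\<psi>d \<omega>))"
      by (rule norm_fourier_inv_le)
    also have "\<dots> \<le> 1 / (2 * pi) * (LINT \<omega>|lborel. C * h\<^sup>2 * (\<bar>\<omega>\<bar> powr (\<alpha> + 2) * norm (\<psi> \<omega>)))"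
    proof (intro mult_left_mono integral_mono integrable_norm int_d integrable_mult_right \<psi>2)
      fix \<omega>
      \<comment> \<open>In this variable both symbols are \<open>h powr (- \<alpha>)\<close> times
        functions of \<open>z\<close>. The symbol bound then contributes \<open>h powr (- \<alpha>)
        * (h * \<bar>\<omega>\<bar>) powr (\<alpha> + 2)\<close>, which leaves
        \<open>h\<^sup>2\<close>.\<close>
      define z where "z = h * \<omega>"
      define S where "S = (1 - cis (- z)) powr of_real \<alpha> * (of_real a * cis (z * of_int p) + of_real b * cis (z * of_int q))
           - (\<i> * of_real z) powr of_real \<alpha>"
      \<comment> \<open>A positive real factor does not change the argument, so it can be taken out
        of the principal power.\<close>
      have D: "(\<i> * of_real z) powr of_real \<alpha> = of_real (h powr \<alpha>) * ?D \<omega>"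
      proof (cases "\<omega> = 0")
        case False
        have "Ln (\<i> * of_real z) = Ln (of_real h * (\<i> * of_real \<omega>))" by (simp add: z_def mult_ac)
        also have "\<dots> = of_real (ln h) + Ln (\<i> * of_real \<omega>)"
          using False h by (subst Ln_times_of_real) (auto simp: Ln_of_real)
        finally show ?thesis
          using False h by (simp add: powr_def z_def ring_distribs exp_add flip: exp_of_real)
      qed (simp add: z_def)
      have "\<psi>d \<omega> = of_real (1 / h powr \<alpha>) * (S * \<psi> \<omega>)"
      proof -
        have z: "\<omega> * (of_int p * h) = z * of_int p" "\<omega> * (of_int q * h) = z * of_int q" "\<omega> * h = z"
          by (simp_all add: z_def)
        have D': "?D \<omega> = of_real (1 / h powr \<alpha>) * (\<i> * of_real z) powr of_real \<alpha>"
          unfolding D using h by simp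
        show ?thesis
          unfolding \<psi>d_def S_def grunwald_symbol_def z D' by (simp add: algebra_simps)
      qed
      hence "norm (\<psi>d \<omega>) = 1 / h powr \<alpha> * (norm S * norm (\<psi> \<omega>))"
        by (simp add: norm_mult norm_divide)
      also have "\<dots> \<le> 1 / h powr \<alpha> * (C * \<bar>z\<bar> powr (\<alpha> + 2) * norm (\<psi> \<omega>))"
        unfolding S_def by (intro mult_left_mono mult_right_mono C) auto
      also have "\<bar>z\<bar> powr (\<alpha> + 2) = h powr \<alpha> * h\<^sup>2 * \<bar>\<omega>\<bar> powr (\<alpha> + 2)"
        using h by (simp add: z_def abs_mult powr_mult powr_add)
      also have "1 / h powr \<alpha> * (C * (h powr \<alpha> * h\<^sup>2 * \<bar>\<omega>\<bar> powr (\<alpha> + 2)) * norm (\<psi> \<omega>)) =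
          C * h\<^sup>2 * (\<bar>\<omega>\<bar> powr (\<alpha> + 2) * norm (\<psi> \<omega>))"
        using h by simp
      finally show "norm (\<psi>d \<omega>) \<le> C * h\<^sup>2 * (\<bar>\<omega>\<bar> powr (\<alpha> + 2) * norm (\<psi> \<omega>))" .
    qed auto
    also have "\<dots> = 1 / (2 * pi) * (C * (LINT \<omega>|lborel. \<bar>\<omega>\<bar> powr (\<alpha> + 2) * norm (\<psi> \<omega>))) * h\<^sup>2"
      by simp
    finally show ?thesis .
  qed
  thus ?thesis by blast
qed

section \<open>Riemann-Liouville derivatives as Fourier multipliers\<close>

lemma rl_integrand_kernel:
  "indicator {..<x} \<xi> *\<^sub>R rl_integrand \<alpha> u x \<xi> = u \<xi> * of_real (power_kernel (real (rl_order \<alpha>) - \<alpha>) (x - \<xi>))"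
proof (cases "\<xi> < x")
  case True
  have "(x - \<xi>) powr (real (rl_order \<alpha>) - \<alpha> - 1) = inverse ((x - \<xi>) powr (\<alpha> - real (rl_order \<alpha>) + 1))"
    by (subst powr_minus[symmetric]) (simp add: algebra_simps)
  thus ?thesis using True by (simp add: rl_integrand_def power_kernel_def divide_inverse)
qed (simp add: power_kernel_def)

text \<open>By linearity the difference passes to the kernel, which turns a convolution with a
  non-integrable kernel into one with an integrable kernel.\<close>

lemma bdiff_rl_integral:
  assumes "\<And>x. set_integrable lborel {..<x} (rl_integrand \<alpha> u x)"
  shows "bdiff h (rl_integral \<alpha> u) = (\<lambda>x. LINT y|lborel. u y * of_real (kernel_diff (real (rl_order \<alpha>) - \<alpha>) h (x - y)))"
proof
  fix x
  have int: "integrable lborel (\<lambda>\<xi>. u \<xi> * of_real (power_kernel (real (rl_order \<alpha>) - \<alpha>) (x - \<xi>)))" for x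
    using assms[of x] unfolding set_integrable_def rl_integrand_kernel .
  have shift: "x - h - y = x - y - h" for y by simp
  show "bdiff h (rl_integral \<alpha> u) x = (LINT y|lborel. u y * of_real (kernel_diff (real (rl_order \<alpha>) - \<alpha>) h (x - y)))"
    unfolding bdiff_def rl_integral_def set_lebesgue_integral_def rl_integrand_kernel
    by (subst Bochner_Integration.integral_diff[OF int int, symmetric])
       (simp add: kernel_diff_def ring_distribs shift)
qed

lemma rl_order_add_2: "\<alpha> > 0 \<Longrightarrow> rl_order (\<alpha> + 2) = rl_order \<alpha> + 2"
  by (simp add: rl_order_def nat_add_distrib)

lemma rl_order_bounds:
  assumes "\<alpha> > 0"
  shows "rl_order \<alpha> \<ge> 1" "0 \<le> real (rl_order \<alpha>) - \<alpha>" "real (rl_order \<alpha>) - \<alpha> < 1"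
  using assms unfolding rl_order_def by linarith+

text \<open>Raising the order by \<open>2\<close> raises \<open>rl_order\<close> by
  \<open>2\<close>, so the kernel exponent is unchanged: for noninteger \<open>\<alpha>\<close> the
  derivatives of orders \<open>\<alpha>\<close> and \<open>\<alpha> + 2\<close> differentiate the
  same integral.\<close>

lemma rl_integral_add_2: "\<alpha> > 0 \<Longrightarrow> rl_integral (\<alpha> + 2) u = rl_integral \<alpha> u"
  by (simp add: rl_integral_def[abs_def] rl_integrand_def[abs_def] rl_order_add_2)

lemma rl_integrand_add_2: "\<alpha> > 0 \<Longrightarrow> rl_integrand (\<alpha> + 2) u = rl_integrand \<alpha> u"
  by (simp add: rl_integrand_def[abs_def] rl_order_add_2)

lemma (in fractional_antiderivative) fourier_u_integrable:
  "integrable lborel (fourier u)"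
proof -
  have "integrable lborel (\<lambda>\<omega>. \<bar>\<omega>\<bar> powr 0 * norm (fourier u \<omega>))"
    using \<sigma> F(2) by (intro integrable_powr_fourier) auto
  \<comment> \<open>The origin is excluded because \<open>0 powr 0\<close> is
    \<open>0\<close>.\<close>
  moreover have "AE \<omega> in lborel. \<bar>\<omega>\<bar> powr 0 * norm (fourier u \<omega>) = norm (fourier u \<omega>)"
    using AE_lborel_singleton[of 0] by eventually_elim auto
  ultimately have "integrable lborel (\<lambda>\<omega>. norm (fourier u \<omega>))"
    by (subst (asm) integrable_cong_AE) auto
  thus ?thesis by (rule integrable_norm_cancel) auto
qed

lemma (in fractional_antiderivative) nth_deriv_F_powr:
  assumes k: "1 \<le> k" "k \<le> m"
  defines "\<alpha> \<equiv> real k - \<sigma>"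
  shows "integrable lborel (\<lambda>\<omega>. (\<i> * of_real \<omega>) powr of_real \<alpha> * fourier u \<omega>)"
    and "nth_deriv k F = (\<lambda>x. c * fourier_inv (\<lambda>\<omega>. (\<i> * of_real \<omega>) powr of_real \<alpha> * fourier u \<omega>) x)"
proof -
  let ?\<psi> = "\<lambda>\<omega>. (\<i> * of_real \<omega>) ^ k * (c * (\<i> * of_real \<omega>) powr (- \<sigma>)) * fourier u \<omega>"
  let ?\<phi> = "\<lambda>\<omega>. c * ((\<i> * of_real \<omega>) powr of_real \<alpha> * fourier u \<omega>)"
  have ae: "AE \<omega> in lborel. ?\<psi> \<omega> = ?\<phi> \<omega>"
    using AE_lborel_singleton[of 0]
  proof eventually_elim
    case (elim \<omega>)
    have "(\<i> * complex_of_real \<omega>) powr of_real \<alpha> = (\<i> * of_real \<omega>) powr (of_nat k + of_real (- \<sigma>))"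
      by (simp add: \<alpha>_def)
    also have "\<dots> = (\<i> * of_real \<omega>) powr of_nat k * (\<i> * of_real \<omega>) powr of_real (- \<sigma>)"
      by (rule powr_add)
    also have "(\<i> * complex_of_real \<omega>) powr of_nat k = (\<i> * of_real \<omega>) ^ k"
      using elim by (simp add: powr_nat')
    finally show ?case by (simp add: mult_ac)
  qed
  have "integrable lborel ?\<phi>"
    using integrable_symbol_fourier[OF k(2)] ae by (subst (asm) integrable_cong_AE) auto
  thus "integrable lborel (\<lambda>\<omega>. (\<i> * of_real \<omega>) powr of_real \<alpha> * fourier u \<omega>)"
    by (rule integrable_cmult_cancel) (use c in simp)
  have "nth_deriv k F = fourier_inv ?\<phi>"
    unfolding nth_deriv_F[OF k] by (rule fourier_inv_cong_AE[OF ae]) auto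
  thus "nth_deriv k F = (\<lambda>x. c * fourier_inv (\<lambda>\<omega>. (\<i> * of_real \<omega>) powr of_real \<alpha> * fourier u \<omega>) x)"
    by (simp only: fourier_inv_def[abs_def] mult.left_commute[of "cis _"] integral_mult_right_zero mult.left_commute[of _ "complex_of_real c"])
qed

text \<open>Both cases instantiate the locale with \<open>m = n + 2\<close>: its top derivative
  yields the integrability with weight \<open>\<alpha> + 2\<close>, and its \<open>n\<close>-th
  derivative is the derivative of order \<open>\<alpha>\<close> up to the factor \<open>c\<close>.
  What remains is to replace \<open>u\<close> by its continuous representative.\<close>

lemma rl_deriv_fourier:
  assumes \<alpha>: "\<alpha> > 0" and u: "integrable lborel u"
    and diff: "rl_differentiable (\<alpha> + 2) u"
    and D: "integrable lborel (rl_deriv (\<alpha> + 2) u)" "integrable lborel (fourier (rl_deriv (\<alpha> + 2) u))"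
  defines "\<psi> \<equiv> fourier u"
  shows "integrable lborel \<psi>"
    and "integrable lborel (\<lambda>\<omega>. (\<i> * of_real \<omega>) powr of_real \<alpha> * \<psi> \<omega>)"
    and "integrable lborel (\<lambda>\<omega>. \<bar>\<omega>\<bar> powr (\<alpha> + 2) * norm (\<psi> \<omega>))"
    and "rl_deriv \<alpha> (fourier_inv \<psi>) = fourier_inv (\<lambda>\<omega>. (\<i> * of_real \<omega>) powr of_real \<alpha> * \<psi> \<omega>)"
    and "rl_differentiable \<alpha> (fourier_inv \<psi>)"
proof -
  define n \<sigma> where "n = rl_order \<alpha>" and "\<sigma> = real n - \<alpha>"
  have n: "n \<ge> 1" "rl_order (\<alpha> + 2) = n + 2" and \<sigma>: "0 \<le> \<sigma>" "\<sigma> < 1"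
    using rl_order_bounds[OF \<alpha>] rl_order_add_2[OF \<alpha>] by (auto simp: n_def \<sigma>_def)
  have \<alpha>_eq: "real n - \<sigma> = \<alpha>" "real (n + 2) - \<sigma> = \<alpha> + 2" by (simp_all add: \<sigma>_def)
  have "integrable lborel \<psi> \<and> integrable lborel (\<lambda>\<omega>. (\<i> * of_real \<omega>) powr of_real \<alpha> * \<psi> \<omega>) \<and>
    integrable lborel (\<lambda>\<omega>. \<bar>\<omega>\<bar> powr (\<alpha> + 2) * norm (\<psi> \<omega>)) \<and>
    rl_deriv \<alpha> (fourier_inv \<psi>) = fourier_inv (\<lambda>\<omega>. (\<i> * of_real \<omega>) powr of_real \<alpha> * \<psi> \<omega>) \<and>
    rl_differentiable \<alpha> (fourier_inv \<psi>)"
  proof (cases "\<sigma> = 0")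
    case True
    hence \<alpha>n: "\<alpha> = real n" "\<alpha> + 2 = real (n + 2)" by (auto simp: \<sigma>_def)
    have diff': "times_differentiable (n + 2) u"
      using diff unfolding rl_differentiable_def n(2) by (simp only: \<alpha>n(2) simp_thms if_True)
    have deriv: "rl_deriv (\<alpha> + 2) u = nth_deriv (n + 2) u"
      unfolding rl_deriv_def[abs_def] n(2) by (simp only: \<alpha>n(2) simp_thms if_True)
    \<comment> \<open>For integer order no integral is taken, and
      \<open>(\<i> * \<omega>) powr 0\<close> is \<open>1\<close> away from the origin.\<close>
    interpret fractional_antiderivative u u "n + 2" 0 1
    proof
      fix h \<omega> :: real assume h: "h > 0"
      show "integrable lborel (bdiff h u)" by (rule integrable_bdiff[OF u])
      assume "\<omega> \<noteq> 0"
      thus "fourier (bdiff h u) \<omega> = (1 - cis (- (\<omega> * h))) * (of_real 1 * (\<i> * \<omega>) powr of_real (- 0)) * fourier u \<omega>"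
        by (simp add: fourier_bdiff[OF u])
    qed (use diff' D[unfolded deriv] u in auto)
    have "u differentiable (at x)" for x
      using has_vector_derivative_nth_deriv[OF diff', of 0 x] by (auto intro: differentiableI_vector)
    hence "continuous_on UNIV u"
      by (intro continuous_at_imp_continuous_on ballI differentiable_imp_continuous_within)
    \<comment> \<open>Here differentiability makes \<open>u\<close> continuous, so inversion holds
      at every point and the representative is \<open>u\<close> itself.\<close>
    hence u_eq: "fourier_inv \<psi> = u"
      using fourier_inversion_continuous[OF u fourier_u_integrable] by (simp add: \<psi>_def)
    have "rl_deriv \<alpha> u = nth_deriv n u"
      unfolding rl_deriv_def[abs_def] n_def[symmetric] by (simp only: \<alpha>n(1) simp_thms if_True)
    hence "rl_deriv \<alpha> u = fourier_inv (\<lambda>\<omega>. (\<i> * of_real \<omega>) powr of_real \<alpha> * \<psi> \<omega>)"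
      using nth_deriv_F_powr(2)[of n] n \<alpha>n by (simp add: \<psi>_def)
    moreover have "rl_differentiable \<alpha> u"
      using times_differentiable_mono[OF diff', of n]
      unfolding rl_differentiable_def n_def[symmetric] by (simp add: \<alpha>n(1))
    ultimately show ?thesis
      unfolding u_eq using fourier_u_integrable nth_deriv_F_powr(1)[of n] integrable_powr_fourier[of "\<alpha> + 2"] n \<alpha>n \<alpha>
      by (auto simp: \<psi>_def)
  next
    case False
    hence \<sigma>0: "\<sigma> > 0" using \<sigma> by simp
    have \<alpha>n: "\<alpha> \<noteq> real n" "\<alpha> + 2 \<noteq> real (n + 2)" using False by (auto simp: \<sigma>_def)
    define F where "F = rl_integral \<alpha> u"
    have si: "set_integrable lborel {..<x} (rl_integrand \<alpha> u x)" for x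
      using diff \<alpha>n \<alpha> unfolding rl_differentiable_def n(2) by (simp add: rl_integrand_add_2)
    have diff': "times_differentiable (n + 2) F"
      using diff \<alpha>n \<alpha> unfolding rl_differentiable_def n(2) by (simp add: rl_integral_add_2 F_def)
    have "real (rl_order (\<alpha> + 2)) - (\<alpha> + 2) = \<sigma>" by (simp add: n \<sigma>_def)
    hence deriv: "rl_deriv (\<alpha> + 2) u = (\<lambda>x. of_real (1 / Gamma \<sigma>) * nth_deriv (n + 2) F x)"
      using \<alpha>n \<alpha> unfolding rl_deriv_def[abs_def] by (simp add: n rl_integral_add_2 F_def)
    have Gamma_pos: "Gamma \<sigma> > 0" using \<sigma>0 by (rule Gamma_real_pos)
    have FG: "fourier (\<lambda>x. of_real (1 / Gamma \<sigma>) * g x) = (\<lambda>\<omega>. of_real (1 / Gamma \<sigma>) * fourier g \<omega>)" for g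
      by (simp only: fourier_cis[abs_def] mult.left_commute[of "cis _"] integral_mult_right_zero)
    interpret fractional_antiderivative F u "n + 2" \<sigma> "Gamma \<sigma>"
    proof
      have nz: "complex_of_real (1 / Gamma \<sigma>) \<noteq> 0" using Gamma_pos by simp
      show "integrable lborel (nth_deriv (n + 2) F)"
        using D(1) nz unfolding deriv by (rule integrable_cmult_cancel)
      show "integrable lborel (fourier (nth_deriv (n + 2) F))"
        using D(2) nz unfolding deriv FG by (rule integrable_cmult_cancel)
      fix h \<omega> :: real assume h: "h > 0"
      have K: "integrable lborel (\<lambda>t. complex_of_real (kernel_diff \<sigma> h t))"
        using \<sigma>0 \<sigma> h by (intro integrable_of_real integrable_kernel_diff)
      have bd: "bdiff h F = (\<lambda>x. LINT y|lborel. u y * of_real (kernel_diff \<sigma> h (x - y)))"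
        using bdiff_rl_integral[of \<alpha> u h] si by (simp add: F_def \<sigma>_def n_def)
      show "integrable lborel (bdiff h F)"
        unfolding bd by (rule integrable_convolution[OF u K])
      assume "\<omega> \<noteq> 0"
      thus "fourier (bdiff h F) \<omega> = (1 - cis (- (\<omega> * h))) * (of_real (Gamma \<sigma>) * (\<i> * \<omega>) powr of_real (- \<sigma>)) * fourier u \<omega>"
        unfolding bd using \<sigma>0 \<sigma> h
        by (simp add: fourier_convolution[OF u K] fourier_kernel_diff mult_ac)
    qed (use diff' u \<sigma> Gamma_pos in auto)
    have v: "AE x in lborel. fourier_inv \<psi> x = u x"
      using fourier_inversion[OF u fourier_u_integrable] by eventually_elim (simp add: \<psi>_def)
    have [measurable]: "fourier_inv \<psi> \<in> borel_measurable borel"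
      using continuous_fourier_inv[OF fourier_u_integrable] unfolding \<psi>_def
      by (rule borel_measurable_continuous_onI)
    \<comment> \<open>Changing \<open>u\<close> on a null set changes none of its Riemann-Liouville
      integrals, so \<open>fourier_inv \<psi>\<close> has the same \<open>F\<close> at every
      point.\<close>
    have ae: "AE \<xi> in lborel. indicator {..<x} \<xi> *\<^sub>R rl_integrand \<alpha> (fourier_inv \<psi>) x \<xi> = indicator {..<x} \<xi> *\<^sub>R rl_integrand \<alpha> u x \<xi>" for x
      using v by eventually_elim (simp add: rl_integrand_def)
    have meas: "(\<lambda>\<xi>. indicator {..<x} \<xi> *\<^sub>R rl_integrand \<alpha> (fourier_inv \<psi>) x \<xi>) \<in> borel_measurable lborel"
      "(\<lambda>\<xi>. indicator {..<x} \<xi> *\<^sub>R rl_integrand \<alpha> u x \<xi>) \<in> borel_measurable lborel" for x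
      unfolding rl_integrand_def by measurable
    have si': "set_integrable lborel {..<x} (rl_integrand \<alpha> (fourier_inv \<psi>) x)" for x
      using si[of x] unfolding set_integrable_def by (subst integrable_cong_AE[OF meas ae])
    have F': "rl_integral \<alpha> (fourier_inv \<psi>) = F"
      unfolding F_def rl_integral_def[abs_def] set_lebesgue_integral_def
      by (intro ext integral_cong_AE meas ae)
    have "rl_deriv \<alpha> (fourier_inv \<psi>) = (\<lambda>x. of_real (1 / Gamma \<sigma>) * nth_deriv n F x)"
      using \<alpha>n unfolding rl_deriv_def[abs_def] by (simp add: F' n_def[symmetric] \<sigma>_def)
    also have "\<dots> = fourier_inv (\<lambda>\<omega>. (\<i> * of_real \<omega>) powr of_real \<alpha> * \<psi> \<omega>)"
      using nth_deriv_F_powr(2)[of n] n less_imp_neq[OF Gamma_pos] by (simp add: \<alpha>_eq \<psi>_def)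
    finally have "rl_deriv \<alpha> (fourier_inv \<psi>) = \<dots>" .
    moreover have "rl_differentiable \<alpha> (fourier_inv \<psi>)"
      using times_differentiable_mono[OF diff', of n] si' \<alpha>n
      unfolding rl_differentiable_def n_def[symmetric] F' by simp
    ultimately show ?thesis
      using fourier_u_integrable nth_deriv_F_powr(1)[of n] integrable_powr_fourier[of "\<alpha> + 2"] n \<alpha>_eq \<alpha>
      by (auto simp: \<psi>_def)
  qed
  thus "integrable lborel \<psi>"
    and "integrable lborel (\<lambda>\<omega>. (\<i> * of_real \<omega>) powr of_real \<alpha> * \<psi> \<omega>)"
    and "integrable lborel (\<lambda>\<omega>. \<bar>\<omega>\<bar> powr (\<alpha> + 2) * norm (\<psi> \<omega>))"
    and "rl_deriv \<alpha> (fourier_inv \<psi>) = fourier_inv (\<lambda>\<omega>. (\<i> * of_real \<omega>) powr of_real \<alpha> * \<psi> \<omega>)"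
    and "rl_differentiable \<alpha> (fourier_inv \<psi>)"
    by blast+
qed

text \<open>For noninteger order the Riemann-Liouville conditions see \<open>u\<close> only up to
  null sets, whereas the difference operator samples single points. The pointwise estimate is
  therefore made for the continuous representative, which for integer \<open>\<alpha>\<close> is
  \<open>u\<close> itself. The constant comes from a bound valid for all
  \<open>h > 0\<close>.\<close>

theorem theorem1:
  fixes \<alpha> :: real and p q :: int and u :: "real \<Rightarrow> complex"
  assumes "\<alpha> > 0" and "p \<noteq> q"
    and "integrable lborel u"
    and "rl_differentiable (\<alpha> + 2) u"
    and "integrable lborel (rl_deriv (\<alpha> + 2) u)"
    and "integrable lborel (fourier (rl_deriv (\<alpha> + 2) u))"
  shows "\<exists>v. continuous_on UNIV v \<and> (AE x in lborel. v x = u x) \<and>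
           rl_differentiable \<alpha> v \<and>
           (\<forall>h>0. \<forall>x. summable (grunwald_term \<alpha> p h v x) \<and> summable (grunwald_term \<alpha> q h v x)) \<and>
           (\<exists>C. \<forall>\<^sub>F h in at_right 0. \<forall>x. norm (wsgd \<alpha> p q h v x - rl_deriv \<alpha> v x) \<le> C * h\<^sup>2)"
proof -
  note R = rl_deriv_fourier[OF assms(1,3-6)]
  define v where "v = fourier_inv (fourier u)"
  obtain C where C: "\<And>h x. h > 0 \<Longrightarrow> norm (wsgd \<alpha> p q h v x - rl_deriv \<alpha> v x) \<le> C * h\<^sup>2"
    using wsgd_fourier_inv_error[OF assms(1,2) R(1-3)] unfolding v_def R(4) by blast
  show ?thesis
  proof (intro exI[of _ v] conjI allI impI)
    show "continuous_on UNIV v" unfolding v_def by (rule continuous_fourier_inv[OF R(1)])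
    show "AE x in lborel. v x = u x"
      using fourier_inversion[OF assms(3) R(1)] by eventually_elim (simp add: v_def)
    show "rl_differentiable \<alpha> v" unfolding v_def by (rule R(5))
    show "\<exists>C. \<forall>\<^sub>F h in at_right 0. \<forall>x. norm (wsgd \<alpha> p q h v x - rl_deriv \<alpha> v x) \<le> C * h\<^sup>2"
      using C by (intro exI[of _ C] eventually_mono[OF eventually_at_right_less]) auto
  qed (unfold v_def, (rule summable_grunwald_term[OF assms(1) R(1)]; assumption)+)
qed

end
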